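(* Let $p$ be an odd prime, let $m,\alpha$ be positive integers, and put $e=2m$, $q=p^{e}$, $d=\gcd(\alpha,e)$. Suppose that $\frac{m}{d}$ is odd, and let $a,c\in\mathbb{F}_p$ with $a\neq 0$ and $c\ne 0$. Let $D=\{x\in\mathbb{F}_q: Tr(x^{p^{\alpha}+1})=a\}=\{d_1,\dots,d_n\}$ and let $$\mathcal{C}_D=\{(Tr(xd_1)+c,Tr(xd_2)+c,\dots,Tr(xd_n)+c): x\in\mathbb{F}_q\}.$$ Then $\mathcal{C}_D$ is a $[p^{e-1}+p^{m-1},\;e+1]$ linear code over $\mathbb{F}_p$ whose weight distribution is: - weight $(p-1)p^{e-2}$ with multiplicity $\frac12(p-1)(p^{e-1}+p^{m-1})$; - weight $(p-1)p^{e-2}+p^{m-1}$ with multiplicity $2p^{e-1}-(p-2)p^{m-1}-1$; - weight $(p-1)p^{e-2}+2p^{m-1}$ with multiplicity $\frac12(p-3)(p^{e-1}+p^{m-1})$; - weight $p^{e-1}+p^{m-1}$ with multiplicity $1$; and whose complete weight enumerator is $$\begin{aligned}\mathit{CWE}(\mathcal{C}_{D})={}&w_{c}^{p^{e-1}+p^{m-1}}+\bigl(p^{e-1}-(p-1)p^{m-1}-1\bigr)\,w_{c}^{p^{e-2}+p^{m-1}}\prod_{1\le i\le p-1}w_{i+c}^{p^{e-2}}\\ &+(p^{e-1}+p^{m-1})\,w_{c}^{p^{e-2}-\left(\frac{-1}{p}\right)p^{m-1}}\prod_{1\le i\le p-1}w_{i+c}^{p^{e-2}-\left(\frac{i^{2}-c^{2}}{p}\right)p^{m-1}}\\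 &+(p^{e-1}+p^{m-1})\sum_{\substack{1\le i\le p-1\\ i\ne (4a)^{-1}c^{2}\\ \left(\frac{i}{p}\right)=\left(\frac{a}{p}\right)}}w_{c}^{p^{e-2}-\left(\frac{-1}{p}\right)p^{m-1}}\prod_{1\le j\le p-1}w_{j+c}^{p^{e-2}-\left(\frac{j^{2}-4ai}{p}\right)p^{m-1}}\\ &+(p^{e-1}+p^{m-1})\sum_{\substack{1\le i\le p-1\\ \left(\frac{i}{p}\right)\ne\left(\frac{a}{p}\right)}}w_{c}^{p^{e-2}+\left(\frac{-1}{p}\right)p^{m-1}}\prod_{1\le j\le p-1}w_{j+c}^{p^{e-2}-\left(\frac{j^{2}-4ai}{p}\right)p^{m-1}},\end{aligned}$$ where the index of each unknown $w$ is reduced modulo $p$.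
   Context: $Tr$ denotes the trace function from $\mathbb{F}_q$ to $\mathbb{F}_p$, and $\left(\frac{*}{p}\right)$ is the Legendre symbol modulo $p$. An $[n,k]$ linear code over $\mathbb{F}_p$ is a $k$-dimensional subspace of $\mathbb{F}_p^{n}$. Elements of $\mathbb{F}_p$ are identified with $0,1,\dots,p-1$, and $(4a)^{-1}c^2$ is computed in $\mathbb{F}_p$. For a codeword $\mathbf{c}\in\mathbb{F}_p^{n}$, its complete weight enumerator is the monomial $w(\mathbf{c})=w_0^{t_0}w_1^{t_1}\cdots w_{p-1}^{t_{p-1}}$ in the unknowns $w_0,\dots,w_{p-1}$, where $t_i$ is the number of components of $\mathbf{c}$ equal to $i$; the complete weight enumerator of a code $\mathcal{C}$ is $\mathit{CWE}(\mathcal{C})=\sum_{\mathbf{c}\in\mathcal{C}}w(\mathbf{c})$. The weight distribution gives, for each Hamming weight, the number (multiplicity) of codewords having that weight.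
   Formalization: For fixed nonzero c the set C_D has only p^e elements and is not a subspace, so the claim of an [n, e+1] linear code is stated for the F_p-span of C_D (the union of the shifted codes over all shifts in F_p); weight distribution and CWE are for C_D itself. *)

theory Defs
  imports
    "HOL-Library.Poly_Mapping"
    "HOL-Number_Theory.Residues"
    "Berlekamp_Zassenhaus.Finite_Field"
    "Jordan_Normal_Form.VS_Connect"
begin

(* F_p is the type 'p mod_ring with CARD('p) = p prime, whose elements are represented by
   0, ..., p - 1; F_q is an arbitrary finite field type with CARD('p) ^ e elements. *)

definition fp_embed :: "'p::prime_card mod_ring \<Rightarrow> 'q::field" where
  "fp_embed t = of_int (to_int_mod_ring t)"

(* x + x^p + ... + x^(p^(e-1)) lies in the prime field of 'q, and fp_trace e x is that value
   read as an element of F_p; see fp_embed_fp_trace for well-definedness. *)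
definition fp_trace :: "nat \<Rightarrow> 'q::field \<Rightarrow> 'p::prime_card mod_ring" where
  "fp_trace e x = (THE t. fp_embed t = (\<Sum>i<e. x ^ (CARD('p) ^ i)))"

lemma char_eq_card_mod_ring:
  assumes "CARD('q::finite_field) = CARD('p::prime_card) ^ e"
  shows "CHAR('q) = CARD('p)"
proof -
  have pr: "prime CHAR('q)"
    by (rule CHAR_prime)
  have "CHAR('q) dvd CARD('p) ^ e"
    using CHAR_dvd_CARD[where 'a = 'q] assms by simp
  then have "CHAR('q) dvd CARD('p)"
    using pr prime_dvd_power by blast
  then show ?thesis
    using pr prime_card[where 'a = 'p] by (simp add: primes_dvd_imp_eq)
qed

lemma inj_fp_embed:
  assumes "CHAR('q::field) = CARD('p::prime_card)"
  shows "inj (fp_embed :: 'p mod_ring \<Rightarrow> 'q)"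
proof (rule injI)
  fix s t :: "'p mod_ring"
  assume "(fp_embed s :: 'q) = fp_embed t"
  then have "[to_int_mod_ring s = to_int_mod_ring t] (mod int CARD('p))"
    by (simp add: fp_embed_def of_int_eq_iff_cong_CHAR assms)
  moreover have "to_int_mod_ring s \<in> {0..<int CARD('p)}" "to_int_mod_ring t \<in> {0..<int CARD('p)}"
    using range_to_int_mod_ring[where 'a = 'p] by blast+
  ultimately have "to_int_mod_ring s = to_int_mod_ring t"
    by (simp add: cong_def)
  then show "s = t"
    by (metis of_int_mod_ring_to_int_mod_ring)
qed

lemma fp_embed_fp_trace:
  fixes x :: "'q::finite_field"
  assumes q: "CARD('q) = CARD('p::prime_card) ^ e"
  shows "fp_embed (fp_trace e x :: 'p mod_ring) = (\<Sum>i<e. x ^ (CARD('p) ^ i))"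
proof -
  let ?p = "CARD('p)"
  let ?R = "range (fp_embed :: 'p mod_ring \<Rightarrow> 'q)"
  let ?Z = "{y::'q. y ^ ?p = y}"
  define s where "s = (\<Sum>i<e. x ^ (?p ^ i))"
  have ch: "CHAR('q) = ?p"
    by (rule char_eq_card_mod_ring[OF q])
  have pr: "prime CHAR('q)"
    by (rule CHAR_prime)
  have p1: "?p > 1"
    using prime_gt_1_nat[OF prime_card[where 'a = 'p]] .
  have inj: "inj (fp_embed :: 'p mod_ring \<Rightarrow> 'q)"
    by (rule inj_fp_embed[OF ch])
  have sub: "?R \<subseteq> ?Z"
  proof clarify
    fix t :: "'p mod_ring"
    obtain n :: nat where n: "to_int_mod_ring t = int n"
    proof -
      have "to_int_mod_ring t \<in> {0..<int CARD('p)}"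
        using range_to_int_mod_ring[where 'a = 'p] by blast
      then show thesis
        using that[of "nat (to_int_mod_ring t)"] by simp
    qed
    have "(of_nat n :: 'q) ^ ?p = of_nat n"
    proof (induction n)
      case 0
      then show ?case using p1 by (simp add: power_0_left)
    next
      case (Suc n)
      then show ?case
        using freshmans_dream[OF pr ch[symmetric], of 1 "of_nat n"] by simp
    qed
    then show "(fp_embed t :: 'q) ^ ?p = fp_embed t"
      by (simp add: fp_embed_def n)
  qed
  define f :: "'q poly" where "f = Polynomial.monom 1 ?p - Polynomial.monom 1 1"
  have cf: "poly.coeff f ?p = 1"
    using p1 by (simp add: f_def)
  then have "f \<noteq> 0"
    by auto
  then have "card {y. poly f y = 0} \<le> degree f"
    by (rule card_poly_roots_bound)
  also have "degree f \<le> ?p"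
    unfolding f_def using p1 by (intro degree_diff_le) (auto simp: degree_monom_eq)
  also have "{y. poly f y = 0} = ?Z"
    by (simp add: f_def poly_monom)
  finally have "card ?Z \<le> ?p" .
  moreover have "card ?R = ?p"
    using inj by (simp add: card_image)
  ultimately have RZ: "?R = ?Z"
    using sub by (intro card_seteq) auto
  have "s ^ ?p = (\<Sum>i<e. x ^ (?p ^ Suc i))"
    unfolding s_def using freshmans_dream_sum[OF pr ch[symmetric], of "\<lambda>i. x ^ (?p ^ i)" "{..<e}"]
    by (simp add: mult.commute flip: power_mult)
  also have "\<dots> + x = (\<Sum>i<Suc e. x ^ (?p ^ i))"
    by (simp only: sum.lessThan_Suc_shift) simp
  also have "\<dots> = s + x"
    using finite_field_power_card_eq_same[of x] q by (simp add: s_def)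
  finally have "s \<in> ?Z"
    by simp
  then have "s \<in> ?R"
    unfolding RZ .
  then obtain t :: "'p mod_ring" where t: "fp_embed t = s"
    by blast
  then have "fp_embed (THE t :: 'p mod_ring. fp_embed t = s) = s"
    by (rule theI) (rule injD[OF inj], simp add: t)
  then show ?thesis
    by (simp add: fp_trace_def s_def)
qed

definition legendre_symbol :: "'p::prime_card mod_ring \<Rightarrow> int" where
  "legendre_symbol x = Legendre (to_int_mod_ring x) (int CARD('p))"

definition linear_code :: "nat \<Rightarrow> nat \<Rightarrow> 'a::field vec set \<Rightarrow> bool" where
  "linear_code n k C \<longleftrightarrow>
     subspace class_ring C (module_vec TYPE('a) n) \<and>
     vectorspace.dim class_ring ((module_vec TYPE('a) n)\<lparr>carrier := C\<rparr>) = k"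

definition code_span :: "nat \<Rightarrow> 'a::field vec set \<Rightarrow> 'a vec set" where
  "code_span n C = LinearCombinations.module.span class_ring (module_vec TYPE('a) n) C"

(* For c other than 0 this is in general only a coset of the trace code (c = 0), not a
   subspace; the linear code it belongs to is its code_span. *)
definition shifted_trace_code ::
    "nat \<Rightarrow> 'q::field list \<Rightarrow> 'p::prime_card mod_ring \<Rightarrow> 'p mod_ring vec set" where
  "shifted_trace_code e ds c =
     {vec (length ds) (\<lambda>k. fp_trace e (x * ds ! k) + c) | x. True}"

definition coord_count :: "'a vec \<Rightarrow> 'a \<Rightarrow> nat" where
  "coord_count v i = card {k. k < dim_vec v \<and> v $ k = i}"

definition hamming_weight :: "'a::zero vec \<Rightarrow> nat" where
  "hamming_weight v = card {k. k < dim_vec v \<and> v $ k \<noteq> 0}"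

(* A weight table is a list of (weight, multiplicity) rows.  Rows of equal weight are added:
   for some parameters two rows of a table given by formulas describe the same weight. *)
definition weight_distribution :: "'a::zero vec set \<Rightarrow> (nat \<times> rat) list \<Rightarrow> bool" where
  "weight_distribution C tab \<longleftrightarrow>
     (\<forall>w. of_nat (card {v \<in> C. hamming_weight v = w}) =
          (\<Sum>(u, A)\<leftarrow>tab. if u = w then A else 0))"

(* Integer polynomials in unknowns w_i indexed by i in F_p, so that the index of w is
   automatically reduced modulo p: finitely supported maps from monomials (finitely supported
   exponent vectors) to coefficients, with convolution as product. *)
type_synonym 'i int_mpoly = "('i \<Rightarrow>\<^sub>0 nat) \<Rightarrow>\<^sub>0 int"

definition unknown :: "'i \<Rightarrow> 'i int_mpoly" where
  "unknown i = Poly_Mapping.single (Poly_Mapping.single i 1) 1"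

definition codeword_cwe :: "'i::finite vec \<Rightarrow> 'i int_mpoly" where
  "codeword_cwe v = (\<Prod>i\<in>UNIV. unknown i ^ coord_count v i)"

definition cwe :: "'i::finite vec set \<Rightarrow> 'i int_mpoly" where
  "cwe C = (\<Sum>v\<in>C. codeword_cwe v)"

end

(* Q x = Tr (x^(p^alpha + 1)) is a nondegenerate quadratic form on F_q over F_p, and every
   F_p-linear functional is x' |-> B x x' for the polar form B of Q. The scalars y with
   y^(p^alpha + 1) in F_p make all level sets {Q = t}, t /= 0, equally large; counting the pairs
   with Q x = Q y then leaves |{Q = t}| = p^(e-1) -+ p^(m-1), and since the (p^d + 1)-th roots of
   unity act freely on {Q = t} while p^m = -1 modulo p^d + 1, the sign is +.
   The number of y with Q y = a and B x y = r is found by translating along x: for Q x = 0 it does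
   not depend on a unless r = 0, and for Q x /= 0 it depends only on the square class of
   r^2 - 4 a Q x, so that three linear equations determine it. No exponential sums are needed. *)

theory Submission
  imports Defs
begin

section \<open>Squares in a finite field\<close>

text \<open>The counting is kept apart from the field arithmetic: the abstract quadratic spaces
  below know only \<open>Q\<close>, its polar form and cardinalities. Scaling by \<open>F_p\<close>
  multiplies a form by squares only, so by itself it cannot compare the level sets of squares with
  those of nonsquares; multiplication by suitable elements of \<open>F_q\<close> does. Even then the
  pair count determines only the square of the deviation of a level set from its mean, so the
  deviation stays a parameter \<open>\<delta>\<close> until divisibility settles its sign. Oddness
  of m / d acts twice: it excludes the eigenvalue -1 behind a degenerate form, and it gives p^m = -1
  modulo p^d + 1. That d divides m makes \<alpha> / d odd. For nonzero c the words form only a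
  coset. Its span is obtained by adding all constant words, and the dimension e + 1 rests on the
  fact that no nonzero functional is constant on D.\<close>

lemma card_eq_sum_fibres:
  fixes f :: "'a::finite \<Rightarrow> 'b::finite"
  shows "card {x. P x} = (\<Sum>y\<in>UNIV. card {x. P x \<and> f x = y})"
  using sum.group[of "{x. P x}" "UNIV :: 'b set" f "\<lambda>_. 1::nat"] by simp

text \<open>The quadratic character, free of integer representatives;
  \<open>legendre_symbol_eq_qchar\<close> identifies it with the Legendre symbol on
  \<open>F_p\<close>.\<close>

definition qchar :: "'a::field \<Rightarrow> int" where
  "qchar u = (if u = 0 then 0 else if \<exists>w. w\<^sup>2 = u then 1 else -1)"

lemma four_neq_zero: "(2::'a::field) \<noteq> 0 \<Longrightarrow> (4::'a) \<noteq> 0"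
  by (metis mult_2 mult_eq_0_iff numeral_Bit0)

lemma qchar_zero [simp]: "qchar 0 = 0"
  by (simp add: qchar_def)

lemma qchar_cases: "u \<noteq> 0 \<Longrightarrow> qchar u = 1 \<or> qchar u = -1"
  by (simp add: qchar_def)

lemma qchar_eq_1_iff: "qchar u = 1 \<longleftrightarrow> (\<exists>w. w \<noteq> 0 \<and> w\<^sup>2 = u)"
  by (auto simp: qchar_def)

lemma qchar_square: "w \<noteq> 0 \<Longrightarrow> qchar (w\<^sup>2) = 1"
  by (auto simp: qchar_eq_1_iff)

lemma card_square_roots:
  fixes u :: "'a::{field,finite}"
  assumes two: "(2::'a) \<noteq> 0"
  shows "int (card {w. w\<^sup>2 = u}) = 1 + qchar u"
proof (cases "\<exists>w. w\<^sup>2 = u")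
  case True
  then obtain v where v: "v\<^sup>2 = u"
    by blast
  have eq: "{w. w\<^sup>2 = u} = {v, - v}"
    using v by (auto simp: power2_eq_iff)
  have "v = - v \<longleftrightarrow> v = 0"
    using two by (metis add_eq_0_iff mult_2 mult_eq_0_iff neg_equal_0_iff_equal)
  then show ?thesis
    unfolding eq using v by (auto simp: qchar_def)
next
  case False
  then show ?thesis
    by (auto simp: qchar_def)
qed

text \<open>Sorting the field elements by their squares gives \<open>CARD('a)\<close> as the sum of
  all \<open>1 + qchar u\<close>.\<close>

lemma sum_qchar:
  assumes two: "(2::'a::{field,finite}) \<noteq> 0"
  shows "(\<Sum>u\<in>UNIV. qchar (u::'a)) = 0"
proof -
  have "int CARD('a) = int (\<Sum>u\<in>UNIV. card {w::'a. w\<^sup>2 = u})"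
    using card_eq_sum_fibres[of "\<lambda>_. True" "\<lambda>w::'a. w\<^sup>2"] by simp
  also have "\<dots> = (\<Sum>u\<in>UNIV. 1 + qchar (u::'a))"
    by (simp add: card_square_roots[OF two])
  finally show ?thesis
    by (simp add: sum.distrib)
qed

lemma sum_qchar_eq_card_diff:
  shows "(\<Sum>u\<in>UNIV. qchar (u::'a::{field,finite})) =
    int (card {u::'a. qchar u = 1}) - int (card {u::'a. qchar u = -1})"
proof -
  have "(\<Sum>u\<in>UNIV. qchar (u::'a)) =
      (\<Sum>u::'a\<in>UNIV. (if qchar u = 1 then 1 else 0) - (if qchar u = -1 then 1 else 0))"
    by (intro sum.cong) (auto dest: qchar_cases simp: qchar_def)
  also have "\<dots> = int (card {u::'a. qchar u = 1}) - int (card {u::'a. qchar u = -1})"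
    by (simp add: sum_subtractf flip: sum.inter_filter)
  finally show ?thesis .
qed

lemma card_qchar_classes:
  assumes two: "(2::'a::{field,finite}) \<noteq> 0"
  shows "2 * card {u::'a. qchar u = 1} = CARD('a) - 1"
    and "2 * card {u::'a. qchar u = -1} = CARD('a) - 1"
proof -
  have eq: "card {u::'a. qchar u = 1} = card {u::'a. qchar u = -1}"
    using sum_qchar_eq_card_diff[where 'a = 'a] sum_qchar[OF two] by simp
  have "UNIV - {0::'a} = {u::'a. qchar u = 1} \<union> {u. qchar u = -1}"
    using qchar_cases by auto
  moreover have disj: "{u::'a. qchar u = 1} \<inter> {u. qchar u = -1} = {}"
    by auto
  ultimately have "card (UNIV - {0::'a}) = card {u::'a. qchar u = 1} + card {u::'a. qchar u = -1}"
    by (metis (no_types) card_Un_disjoint[OF finite finite] disj)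
  moreover have "card (UNIV - {0::'a}) = CARD('a) - 1"
    by (simp add: card_Diff_singleton)
  ultimately show "2 * card {u::'a. qchar u = 1} = CARD('a) - 1"
    and "2 * card {u::'a. qchar u = -1} = CARD('a) - 1"
    using eq by simp_all
qed

lemma qchar_mult_square: "w \<noteq> 0 \<Longrightarrow> qchar (w\<^sup>2 * u) = qchar u"
proof -
  assume w: "w \<noteq> 0"
  have "(\<exists>v. v\<^sup>2 = w\<^sup>2 * u) \<longleftrightarrow> (\<exists>v. v\<^sup>2 = u)"
  proof
    assume "\<exists>v. v\<^sup>2 = w\<^sup>2 * u"
    then obtain v where "v\<^sup>2 = w\<^sup>2 * u" ..
    then have "(v / w)\<^sup>2 = u"
      using w by (simp add: power_divide)
    then show "\<exists>v. v\<^sup>2 = u" ..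
  next
    assume "\<exists>v. v\<^sup>2 = u"
    then show "\<exists>v. v\<^sup>2 = w\<^sup>2 * u"
      by (metis power_mult_distrib)
  qed
  then show ?thesis
    using w by (simp add: qchar_def)
qed

text \<open>Multiplication by a nonsquare sends the nonzero squares injectively into the nonsquares,
  and both classes have the same size.\<close>

lemma qchar_nonsquare_ratio:
  fixes u v :: "'a::{field,finite}"
  assumes two: "(2::'a) \<noteq> 0" and u: "qchar u = -1" and v: "qchar v = -1"
  obtains w where "w \<noteq> 0" "v = w\<^sup>2 * u"
proof -
  have u0: "u \<noteq> 0"
    using u by auto
  have "(\<lambda>s. s * u) ` {s. qchar s = 1} = {s. qchar s = -1}"
  proof (rule card_seteq)
    show "(\<lambda>s. s * u) ` {s. qchar s = 1} \<subseteq> {s. qchar s = -1}"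
      using u by (auto simp: qchar_eq_1_iff qchar_mult_square)
    have "inj_on (\<lambda>s. s * u) {s. qchar s = 1}"
      using u0 by (auto simp: inj_on_def)
    then show "card {s::'a. qchar s = -1} \<le> card ((\<lambda>s. s * u) ` {s. qchar s = 1})"
      using card_qchar_classes[OF two] by (simp add: card_image)
  qed simp
  then obtain s where "qchar s = 1" "v = s * u"
    using v by force
  then show thesis
    using that by (auto simp: qchar_eq_1_iff)
qed

lemma qchar_mult:
  fixes u v :: "'a::{field,finite}"
  assumes two: "(2::'a) \<noteq> 0"
  shows "qchar (u * v) = qchar u * qchar v"
proof (cases "u = 0 \<or> v = 0")
  case False
  then have uv: "u \<noteq> 0" "v \<noteq> 0"
    by auto
  consider "qchar u = 1" | "qchar v = 1" | "qchar u = -1" "qchar v = -1"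
    using qchar_cases uv by blast
  then show ?thesis
  proof cases
    case 1
    then show ?thesis
      by (auto simp: qchar_eq_1_iff qchar_mult_square)
  next
    case 2
    then show ?thesis
      by (auto simp: qchar_eq_1_iff qchar_mult_square mult.commute[of u])
  next
    case 3
    then obtain w where w: "w \<noteq> 0" "v = w\<^sup>2 * u"
      using qchar_nonsquare_ratio[OF two] by metis
    then have "u * v = (w * u)\<^sup>2"
      by (simp add: power2_eq_square)
    then show ?thesis
      using 3 w uv by (simp add: qchar_square)
  qed
qed auto

text \<open>Substituting \<open>(r, w) \<mapsto> r - w\<close> parametrises the hyperbola \<open>r\<^sup>2 - w\<^sup>2 = D\<close> by the nonzero
  elements of the field.\<close>
lemma sum_qchar_quadratic:
  fixes D :: "'a::{field,finite}"
  assumes two: "(2::'a) \<noteq> 0" and D: "D \<noteq> 0"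
  shows "(\<Sum>r\<in>UNIV. qchar (r\<^sup>2 - D)) = -1"
proof -
  note four = four_neq_zero[OF two]
  have "bij_betw (\<lambda>(r, w). r - w) (SIGMA r:UNIV. {w. w\<^sup>2 = r\<^sup>2 - D}) (UNIV - {0::'a})"
  proof (rule bij_betw_byWitness[where f' = "\<lambda>z. ((z + D / z) / 2, (D / z - z) / 2)"])
    have *: "r - w \<noteq> 0 \<and> D / (r - w) = r + w" if "w\<^sup>2 = r\<^sup>2 - D" for r w
    proof -
      have "D = (r - w) * (r + w)"
        using that by (simp add: algebra_simps power2_eq_square)
      moreover from this have "r - w \<noteq> 0"
        using D by auto
      ultimately show ?thesis
        by simp
    qed
    show "\<forall>x\<in>SIGMA r:UNIV. {w. w\<^sup>2 = r\<^sup>2 - D}.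
        (\<lambda>z. ((z + D / z) / 2, (D / z - z) / 2)) ((\<lambda>(r, w). r - w) x) = x"
      using * two by (auto simp: field_simps)
    show "\<forall>z\<in>UNIV - {0}. (\<lambda>(r, w). r - w) ((z + D / z) / 2, (D / z - z) / 2) = z"
      using two four by (auto simp: field_simps)
    show "(\<lambda>(r, w). r - w) ` (SIGMA r:UNIV. {w. w\<^sup>2 = r\<^sup>2 - D}) \<subseteq> UNIV - {0}"
      using * by fastforce
    have "((D / z - z) / 2)\<^sup>2 = ((z + D / z) / 2)\<^sup>2 - D" if "z \<noteq> 0" for z
    proof -
      have "(z + D / z)\<^sup>2 = (D / z - z)\<^sup>2 + 4 * D"
        using that by (simp add: power2_eq_square field_simps)
      then show ?thesis
        using four by (simp add: power_divide field_simps)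
    qed
    then show "(\<lambda>z. ((z + D / z) / 2, (D / z - z) / 2)) ` (UNIV - {0})
        \<subseteq> (SIGMA r:UNIV. {w. w\<^sup>2 = r\<^sup>2 - D})"
      by auto
  qed
  then have "card (SIGMA r:UNIV. {w. w\<^sup>2 = r\<^sup>2 - D}) = CARD('a) - 1"
    by (simp add: bij_betw_same_card card_Diff_singleton)
  then have "int (\<Sum>r\<in>UNIV. card {w. w\<^sup>2 = r\<^sup>2 - D}) = int CARD('a) - 1"
    by (simp add: of_nat_diff)
  then have "(\<Sum>r\<in>UNIV. 1 + qchar (r\<^sup>2 - D)) = int CARD('a) - 1"
    by (simp add: card_square_roots[OF two])
  then show ?thesis
    by (simp add: sum.distrib)
qed

section \<open>Counting points of quadrics over a finite field\<close>

text \<open>\<open>Q_add\<close> makes \<open>B\<close> the polarisation of \<open>Q\<close> and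
  hence symmetric, so linearity is demanded in one argument only. Cardinalities take the place of
  the dimension.\<close>

locale quadratic_space = vector_space scale
  for scale :: "'k::{field,finite} \<Rightarrow> 'v::{ab_group_add,finite} \<Rightarrow> 'v" +
  fixes Q :: "'v \<Rightarrow> 'k" and B :: "'v \<Rightarrow> 'v \<Rightarrow> 'k"
  assumes two: "(2::'k) \<noteq> 0"
    and Q_scale: "Q (scale t x) = t\<^sup>2 * Q x"
    and Q_add: "Q (x + y) = Q x + Q y + B x y"
    and B_add: "B x (y + z) = B x y + B x z"
    and B_scale: "B x (scale t y) = t * B x y"
    and nondegenerate: "x \<noteq> 0 \<Longrightarrow> \<exists>y. B x y \<noteq> 0"
begin

lemma B_commute: "B x y = B y x"
  using Q_add[of x y] Q_add[of y x] by (simp add: add.commute)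

lemma B_self: "B x x = 2 * Q x"
proof -
  have "scale 2 x = x + x"
    by (metis one_add_one scale_left_distrib scale_one)
  then have "4 * Q x = 2 * Q x + B x x"
    using Q_scale[of 2 x] Q_add[of x x] by simp
  then show ?thesis
    by (simp add: algebra_simps)
qed

lemma Q_zero [simp]: "Q 0 = 0"
  using Q_scale[of 0 0] by simp

lemma B_zero_left [simp]: "B 0 y = 0"
  using B_scale[of y 0 0] by (simp add: B_commute[of 0])

lemma bij_scale: "t \<noteq> 0 \<Longrightarrow> bij (scale t)"
  by (rule o_bij[of "scale (inverse t)"]) (auto simp: fun_eq_iff)

lemma bij_translate: "bij (\<lambda>y::'v. y + v)"
  by (rule o_bij[of "\<lambda>y. y - v"]) (auto simp: fun_eq_iff)

lemma card_bij_Collect: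
  fixes f :: "'v \<Rightarrow> 'v"
  assumes "bij f" "\<And>y. P' (f y) \<longleftrightarrow> P y"
  shows "card {y. P' y} = card {y. P y}"
proof -
  have "{y. P' y} = f ` {y. P y}"
    using assms by (auto simp: image_iff) (metis bij_pointE)
  then show ?thesis
    using assms(1) by (metis card_image bij_is_inj inj_on_subset subset_UNIV)
qed

text \<open>Translation along some \<open>y0\<close> with \<open>B h y0\<close> nonzero carries each
  level of the functional onto any other.\<close>

lemma card_hyperplane:
  assumes h: "h \<noteq> 0"
  shows "CARD('k) * card {y. B h y = r} = CARD('v)"
proof -
  obtain y0 where y0: "B h y0 \<noteq> 0"
    using nondegenerate[OF h] by blast
  have "card {y. B h y = r'} = card {y. B h y = r}" for r'
  proof (rule card_bij_Collect)
    show "bij (\<lambda>y. y + scale ((r' - r) / B h y0) y0)"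
      by (rule bij_translate)
  qed (use y0 in \<open>auto simp: B_add B_scale\<close>)
  then have "(\<Sum>r'\<in>UNIV. card {y. B h y = r'}) = (\<Sum>r'\<in>(UNIV :: 'k set). card {y. B h y = r})"
    by (intro sum.cong refl)
  then have "(\<Sum>r'\<in>UNIV. card {y. B h y = r'}) = CARD('k) * card {y. B h y = r}"
    by simp
  then show ?thesis
    using card_eq_sum_fibres[of "\<lambda>_. True" "B h"] by simp
qed

abbreviation level :: "'k \<Rightarrow> nat" where
  "level t \<equiv> card {y. Q y = t}"

text \<open>Pairs \<open>(y, y + h)\<close> with \<open>Q (y + h) = Q y\<close> satisfy the affine equation \<open>B h y = - Q h\<close>.\<close>
lemma second_moment:
  "CARD('k) * (\<Sum>t\<in>UNIV. (level t)\<^sup>2) = CARD('k) * CARD('v) + (CARD('v) - 1) * CARD('v)"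
proof -
  have "(\<Sum>t\<in>UNIV. (level t)\<^sup>2) = (\<Sum>t\<in>UNIV. card {y. Q (fst y) = Q (snd y) \<and> Q (fst y) = t})"
  proof (rule sum.cong)
    fix t
    have "{y. Q (fst y) = Q (snd y) \<and> Q (fst y) = t} = {y. Q y = t} \<times> {y. Q y = t}"
      by auto
    then show "(level t)\<^sup>2 = card {y. Q (fst y) = Q (snd y) \<and> Q (fst y) = t}"
      by (simp add: card_cartesian_product power2_eq_square)
  qed simp
  also have "\<dots> = card {y. Q (fst y) = Q (snd y)}"
    by (rule card_eq_sum_fibres[symmetric])
  also have "\<dots> = card (SIGMA h:UNIV. {y. B h y = - Q h})"
  proof (rule bij_betw_same_card)
    show "bij_betw (\<lambda>y. (fst y - snd y, snd y)) {y. Q (fst y) = Q (snd y)} (SIGMA h:UNIV. {y. B h y = - Q h})"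
    proof (rule bij_betw_byWitness[where f' = "\<lambda>y. (fst y + snd y, snd y)"])
      have "Q x = Q y \<longleftrightarrow> B (x - y) y = - Q (x - y)" for x y
        using Q_add[of "x - y" y] by (auto simp: algebra_simps add_eq_0_iff)
      then show "(\<lambda>y. (fst y - snd y, snd y)) ` {y. Q (fst y) = Q (snd y)}
          \<subseteq> (SIGMA h:UNIV. {y. B h y = - Q h})"
        by auto
    qed (auto simp: Q_add)
  qed
  also have "\<dots> = (\<Sum>h\<in>UNIV. card {y. B h y = - Q h})"
    by simp
  also have "\<dots> = CARD('v) + (\<Sum>h\<in>UNIV - {0}. card {y. B h y = - Q h})"
    by (subst sum.remove[of _ 0]) auto
  finally have "CARD('k) * (\<Sum>t\<in>UNIV. (level t)\<^sup>2) =
      CARD('k) * CARD('v) + (\<Sum>h\<in>UNIV - {0}. CARD('k) * card {y. B h y = - Q h})"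
    by (simp add: distrib_left sum_distrib_left)
  also have "(\<Sum>h\<in>UNIV - {0}. CARD('k) * card {y. B h y = - Q h}) = (CARD('v) - 1) * CARD('v)"
    by (simp add: card_hyperplane card_Diff_singleton)
  finally show ?thesis .
qed

abbreviation section_count :: "'v \<Rightarrow> 'k \<Rightarrow> 'k \<Rightarrow> nat" where
  "section_count x t r \<equiv> card {y. Q y = t \<and> B x y = r}"

lemma level_eq_sum_section: "level t = (\<Sum>r\<in>UNIV. section_count x t r)"
  by (rule card_eq_sum_fibres)

lemma Q_translate: "Q (y + scale w x) = Q y + w * B x y + w\<^sup>2 * Q x"
  by (simp add: Q_add Q_scale B_scale B_commute[of y])

lemma B_translate: "B x (y + scale w x) = B x y + 2 * w * Q x"
  by (simp add: B_add B_scale B_self mult_ac)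

text \<open>For isotropic \<open>x\<close> the translation y + w x keeps \<open>B x y = r\<close>
  and changes \<open>Q y\<close> by w r, which takes every value because r is nonzero.\<close>

lemma section_count_isotropic:
  assumes x: "x \<noteq> 0" "Q x = 0" and r: "r \<noteq> 0"
  shows "CARD('k)\<^sup>2 * section_count x t r = CARD('v)"
proof -
  have "section_count x t' r = section_count x t r" for t'
  proof (rule card_bij_Collect)
    show "bij (\<lambda>y. y + scale ((t' - t) / r) x)"
      by (rule bij_translate)
  qed (use x r in \<open>auto simp: Q_translate B_translate\<close>)
  then have "(\<Sum>t'\<in>UNIV. section_count x t' r) = (\<Sum>t'\<in>(UNIV :: 'k set). section_count x t r)"
    by (intro sum.cong refl)
  moreover have "card {y. B x y = r} = (\<Sum>t'\<in>UNIV. section_count x t' r)"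
    using card_eq_sum_fibres[of "\<lambda>y. B x y = r" Q] by (simp add: conj_commute)
  ultimately have "card {y. B x y = r} = CARD('k) * section_count x t r"
    by simp
  then show ?thesis
    using card_hyperplane[OF x(1), of r] by (simp add: power2_eq_square mult.assoc)
qed

text \<open>As a polynomial in w, Q (y + w x) has discriminant
  \<open>(B x y)\<^sup>2 - 4 * Q x * Q y\<close>, and shifting w preserves it. Since
  \<open>Q x\<close> is nonzero, a suitable shift also moves r to any prescribed r'.\<close>

lemma section_count_anisotropic_shift:
  assumes s: "Q x \<noteq> 0" and eq: "r\<^sup>2 - 4 * Q x * t = r'\<^sup>2 - 4 * Q x * t'"
  shows "section_count x t' r' = section_count x t r"
proof (rule card_bij_Collect)
  let ?w = "(r' - r) / (2 * Q x)"
  show "bij (\<lambda>y. y + scale ?w x)"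
    by (rule bij_translate)
  fix y
  have B: "B x (y + scale ?w x) = r' \<longleftrightarrow> B x y = r"
  proof -
    have "2 * ?w * Q x = r' - r"
      using s two by simp
    then show ?thesis
      by (auto simp: B_translate simp del: times_divide_eq_right)
  qed
  \<comment> \<open>Multiplying by \<open>4 * Q x\<close> clears the denominators of
    \<open>?w\<close>.\<close>
  have "4 * Q x \<noteq> 0"
    using s four_neq_zero[OF two] by simp
  moreover have "4 * Q x * (t + ?w * r + ?w\<^sup>2 * Q x) = 4 * Q x * t'"
  proof -
    have "2 * Q x * ?w = r' - r"
      using s two by simp
    moreover have "4 * Q x * (t + ?w * r + ?w\<^sup>2 * Q x)
        = 4 * Q x * t + 2 * (2 * Q x * ?w) * r + (2 * Q x * ?w)\<^sup>2"
      by (simp add: algebra_simps power2_eq_square)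
    ultimately have "4 * Q x * (t + ?w * r + ?w\<^sup>2 * Q x) = 4 * Q x * t + 2 * (r' - r) * r + (r' - r)\<^sup>2"
      by (simp only:)
    also have "\<dots> = 4 * Q x * t'"
      using eq by (simp add: algebra_simps power2_eq_square)
    finally show ?thesis .
  qed
  ultimately have t': "t + ?w * r + ?w\<^sup>2 * Q x = t'"
    by (rule mult_left_cancel[THEN iffD1])
  have "Q (y + scale ?w x) = t' \<longleftrightarrow> Q y = t" if "B x y = r"
    unfolding Q_translate that t'[symmetric] by auto
  then show "Q (y + scale ?w x) = t' \<and> B x (y + scale ?w x) = r' \<longleftrightarrow> Q y = t \<and> B x y = r"
    using B by blast
qed

text \<open>For r = 0 this says that only the square class of t matters.\<close>

lemma section_count_scale:
  assumes "w \<noteq> 0"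
  shows "section_count x (w\<^sup>2 * t) (w * r) = section_count x t r"
proof (rule card_bij_Collect)
  show "bij (scale w)"
    by (rule bij_scale[OF assms])
qed (use assms in \<open>auto simp: Q_scale B_scale\<close>)

end

text \<open>\<open>k\<close> is the average size of a level set and \<open>l\<close> that of a
  section. \<open>\<delta>\<close> is the deficit of a nonzero level; its sign is left open, since
  the counting arguments cannot see it.\<close>

locale equidistributed_quadratic_space = quadratic_space scale Q B
  for scale :: "'k::{field,finite} \<Rightarrow> 'v::{ab_group_add,finite} \<Rightarrow> 'v"
    and Q :: "'v \<Rightarrow> 'k" and B :: "'v \<Rightarrow> 'v \<Rightarrow> 'k" +
  fixes M :: nat and k l \<delta> :: int
  assumes level_eq: "t \<noteq> 0 \<Longrightarrow> level t = M"
    and card_v: "int CARD('v) = int CARD('k) * k"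
    and k_eq: "k = int CARD('k) * l"
    and M_eq: "int M = k - \<delta>"
begin

lemma card_k_ge: "CARD('k) \<ge> 3"
proof -
  have "card {0, 1, 2 :: 'k} \<le> CARD('k)"
    by (rule card_mono) auto
  moreover have "(1::'k) \<noteq> 2"
    by (metis add_cancel_right_right one_add_one one_neq_zero)
  ultimately show ?thesis
    using two by simp
qed

lemma level_zero: "int (level 0) = k + (int CARD('k) - 1) * \<delta>"
proof -
  have "int CARD('v) = (\<Sum>t\<in>UNIV. int (level t))"
    using card_eq_sum_fibres[of "\<lambda>_. True" Q] by simp
  also have "\<dots> = int (level 0) + (\<Sum>t\<in>UNIV - {0}. int (level t))"
    by (subst sum.remove[of _ 0]) auto
  also have "(\<Sum>t\<in>UNIV - {0}. int (level t)) = (int CARD('k) - 1) * (k - \<delta>)"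
    using card_k_ge by (simp add: level_eq M_eq card_Diff_singleton of_nat_diff)
  finally show ?thesis
    using card_v by (simp add: algebra_simps)
qed

text \<open>The deviations from the mean \<open>k\<close> are (q - 1) \<delta> for t = 0 and
  -\<delta> for the q - 1 other levels. They sum to zero, so the second moment contains \<delta>
  only through its square.\<close>

lemma delta_square: "\<delta>\<^sup>2 = l"
proof -
  let ?q = "int CARD('k)"
  have q: "?q \<ge> 3"
    using card_k_ge by simp
  have "(\<Sum>t\<in>UNIV. (int (level t))\<^sup>2) = (int (level 0))\<^sup>2 + (\<Sum>t\<in>UNIV - {0}. (int (level t))\<^sup>2)"
    by (subst sum.remove[of _ 0]) auto
  also have "(\<Sum>t\<in>UNIV - {0}. (int (level t))\<^sup>2) = (?q - 1) * (k - \<delta>)\<^sup>2"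
    using card_k_ge by (simp add: level_eq M_eq card_Diff_singleton of_nat_diff)
  finally have sum: "(\<Sum>t\<in>UNIV. (int (level t))\<^sup>2) = (k + (?q - 1) * \<delta>)\<^sup>2 + (?q - 1) * (k - \<delta>)\<^sup>2"
    by (simp add: level_zero)
  have "?q * (\<Sum>t\<in>UNIV. (int (level t))\<^sup>2) = int (CARD('k) * (\<Sum>t\<in>UNIV. (level t)\<^sup>2))"
    by simp
  also have "\<dots> = ?q * (?q * k) + (?q * k - 1) * (?q * k)"
    unfolding second_moment using card_v by (simp add: of_nat_diff Suc_leI)
  finally have "?q * ((k + (?q - 1) * \<delta>)\<^sup>2 + (?q - 1) * (k - \<delta>)\<^sup>2) = ?q * (?q * k) + (?q * k - 1) * (?q * k)"
    unfolding sum .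
  then have "(?q * ?q * (?q - 1)) * \<delta>\<^sup>2 = (?q * ?q * (?q - 1)) * l"
    unfolding k_eq by (simp add: algebra_simps power2_eq_square)
  then show ?thesis
    using q by simp
qed

lemma section_count_isotropic_nonzero:
  assumes "x \<noteq> 0" "Q x = 0" "r \<noteq> 0"
  shows "int (section_count x t r) = l"
proof -
  have "int (CARD('k)\<^sup>2 * section_count x t r) = int CARD('v)"
    using section_count_isotropic[OF assms] by simp
  then have "int CARD('k) * (int CARD('k) * int (section_count x t r)) = int CARD('k) * (int CARD('k) * l)"
    by (simp add: card_v k_eq power2_eq_square mult.assoc)
  then show ?thesis
    by simp
qed

text \<open>Translation along \<open>x\<close> says nothing for r = 0; this section is what the q -
  1 others, each of size \<open>l\<close>, leave of the level set.\<close>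

lemma section_count_isotropic_zero:
  assumes "x \<noteq> 0" "Q x = 0" "t \<noteq> 0"
  shows "int (section_count x t 0) = l - \<delta>"
proof -
  have "int (level t) = (\<Sum>r\<in>UNIV. int (section_count x t r))"
    unfolding level_eq_sum_section[of t x] by simp
  also have "\<dots> = int (section_count x t 0) + (\<Sum>r\<in>UNIV - {0}. int (section_count x t r))"
    by (subst sum.remove[of _ 0]) auto
  also have "(\<Sum>r\<in>UNIV - {0}. int (section_count x t r)) = (int CARD('k) - 1) * l"
    using assms card_k_ge
    by (simp add: section_count_isotropic_nonzero card_Diff_singleton of_nat_diff)
  finally show ?thesis
    using assms by (simp add: level_eq M_eq k_eq algebra_simps)
qed

text \<open>Completing the square, \<open>section_count x t r = G (r\<^sup>2 - 4 Q x t)\<close> where \<open>G\<close> is constant on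
  square classes. Its three values are determined by the sizes of the level set of \<open>0\<close>, of the
  level set of one \<open>t\<close> with \<open>Q x * t\<close> a nonsquare, and of a hyperplane.\<close>
lemma section_count_anisotropic:
  assumes s: "Q x \<noteq> 0"
  shows "int (section_count x t r) = l + \<delta> * qchar (r\<^sup>2 - 4 * Q x * t)"
proof -
  let ?q = "int CARD('k)"
  \<comment> \<open>The pair with r = 0 and discriminant u represents all pairs with that
    discriminant.\<close>
  define G where "G u = int (section_count x (- u / (4 * Q x)) 0)" for u
  have four: "(4::'k) \<noteq> 0"
    by (rule four_neq_zero[OF two])
  have G: "int (section_count x t r) = G (r\<^sup>2 - 4 * Q x * t)" for t r
    unfolding G_def of_nat_eq_iff
    by (rule section_count_anisotropic_shift[OF s]) (use s four in \<open>auto simp: field_simps\<close>)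
  have G_scale: "G (w\<^sup>2 * u) = G u" if "w \<noteq> 0" for w u
    unfolding G_def using section_count_scale[OF that, where x = x and t = "- u / (4 * Q x)" and r = 0] by simp
  have "card {u::'k. qchar u = -1} \<noteq> 0"
    using card_qchar_classes(2)[OF two] card_k_ge by linarith
  then obtain v :: 'k where v: "qchar v = -1"
    by (auto simp: card_gt_0_iff simp flip: neq0_conv)
  have v0: "v \<noteq> 0"
    using v by auto
  have G1: "G u = G 1" if "qchar u = 1" for u
    using that G_scale[of _ 1] by (auto simp: qchar_eq_1_iff)
  have Gv: "G u = G v" if "qchar u = -1" for u
    using qchar_nonsquare_ratio[OF two v that] G_scale by metis
  \<comment> \<open>Interpolation between the two square classes; the factor 2 keeps it within the
    integers.\<close>
  have G2: "2 * G u = (G 1 + G v) + qchar u * (G 1 - G v)" if "u \<noteq> 0" for u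
    using qchar_cases[OF that] G1[of u] Gv[of u] by auto
  have split: "(\<Sum>u\<in>UNIV. f u) = f 0 + (\<Sum>u\<in>UNIV - {0}. f u)" for f :: "'k \<Rightarrow> int"
    by (subst sum.remove[of _ 0]) auto
  have card0: "int (card (UNIV - {0::'k})) = ?q - 1"
    using card_k_ge by (simp add: card_Diff_singleton of_nat_diff)
  have e1: "k + (?q - 1) * \<delta> = G 0 + (?q - 1) * G 1"
  proof -
    have "int (level 0) = (\<Sum>r\<in>UNIV. G (r\<^sup>2))"
      unfolding level_eq_sum_section[of 0 x] by (simp add: G)
    also have "\<dots> = G 0 + (\<Sum>r\<in>UNIV - {0::'k}. G (r\<^sup>2))"
      by (simp add: split)
    also have "(\<Sum>r\<in>UNIV - {0}. G (r\<^sup>2)) = (\<Sum>r\<in>UNIV - {0::'k}. G 1)"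
      by (intro sum.cong) (auto intro: G1 qchar_square)
    finally show ?thesis
      by (simp add: level_zero card0)
  qed
  have e2: "2 * G 0 + (?q - 1) * (G 1 + G v) = 2 * k"
  proof -
    have x: "x \<noteq> 0"
      using s by auto
    have "card {y. B x y = 0} = (\<Sum>t\<in>UNIV. section_count x t 0)"
      using card_eq_sum_fibres[of "\<lambda>y. B x y = 0" Q] by (simp add: conj_commute)
    then have "int (card {y. B x y = 0}) = (\<Sum>t\<in>UNIV. G (- 4 * Q x * t))"
      by (simp add: G)
    also have "\<dots> = (\<Sum>u\<in>UNIV. G u)"
      by (rule sum.reindex_bij_witness[of _ "\<lambda>u. u / (- 4 * Q x)" "\<lambda>t. - 4 * Q x * t"])
        (use s four in auto)
    finally have "2 * int (card {y. B x y = 0}) = 2 * G 0 + (\<Sum>u\<in>UNIV - {0}. 2 * G u)"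
      by (simp add: split sum_distrib_left)
    also have "(\<Sum>u\<in>UNIV - {0}. 2 * G u) = (\<Sum>u\<in>UNIV - {0::'k}. (G 1 + G v) + qchar u * (G 1 - G v))"
      by (intro sum.cong) (auto simp: G2)
    also have "\<dots> = (?q - 1) * (G 1 + G v)"
      using sum_qchar[OF two] by (simp add: sum.distrib card0 split flip: sum_distrib_right)
    finally have "2 * int (card {y. B x y = 0}) = 2 * G 0 + (?q - 1) * (G 1 + G v)" .
    moreover have "?q * int (card {y. B x y = 0}) = ?q * k"
      using card_hyperplane[OF x, of 0] card_v by (metis of_nat_mult)
    then have "int (card {y. B x y = 0}) = k"
      by simp
    ultimately show ?thesis
      by simp
  qed
  have e3: "2 * (k - \<delta>) = ?q * (G 1 + G v) - (G 1 - G v)"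
  proof -
    \<comment> \<open>With \<open>4 * Q x * t\<close> a nonsquare,
      \<open>r\<^sup>2 - 4 * Q x * t\<close> never vanishes, so \<open>G 0\<close> is absent from
      this equation.\<close>
    define t where "t = v / (4 * Q x)"
    have t: "t \<noteq> 0" "4 * Q x * t = v"
      using v0 s four by (auto simp: t_def)
    have "int (level t) = (\<Sum>r\<in>UNIV. G (r\<^sup>2 - v))"
      unfolding level_eq_sum_section[of t x] by (simp add: G t)
    then have "2 * int (level t) = (\<Sum>r\<in>UNIV. 2 * G (r\<^sup>2 - v))"
      by (simp add: sum_distrib_left)
    also have "\<dots> = (\<Sum>r\<in>(UNIV::'k set). (G 1 + G v) + qchar (r\<^sup>2 - v) * (G 1 - G v))"
    proof (intro sum.cong refl G2)
      fix r :: 'k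
      show "r\<^sup>2 - v \<noteq> 0"
        using v v0 qchar_square[of r] by (cases "r = 0") auto
    qed
    also have "\<dots> = ?q * (G 1 + G v) - (G 1 - G v)"
      using sum_qchar_quadratic[OF two v0] by (simp add: sum.distrib flip: sum_distrib_right)
    finally show ?thesis
      using t by (simp add: level_eq M_eq)
  qed
  \<comment> \<open>Twice \<open>e1\<close> minus \<open>e2\<close> eliminates
    \<open>G 0\<close>.\<close>
  have "(?q - 1) * (G 1 - G v) = (?q - 1) * (2 * \<delta>)"
    using e1 e2 by (simp add: algebra_simps)
  then have diff: "G 1 - G v = 2 * \<delta>"
    using card_k_ge by simp
  then have "?q * (G 1 + G v) = ?q * (2 * l)"
    using e3 k_eq by (simp add: algebra_simps)
  then have add: "G 1 + G v = 2 * l"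
    by simp
  have "G 0 = l"
    using e2 add k_eq by (simp add: algebra_simps)
  moreover have "G u = l + \<delta> * qchar u" if "u \<noteq> 0" for u
    using G2[OF that] diff add by (simp add: algebra_simps)
  ultimately have "G u = l + \<delta> * qchar u" for u
    by (cases "u = 0") auto
  then show ?thesis
    by (simp add: G)
qed

end

section \<open>The trace of a finite field\<close>

lemma fp_embed_add:
  assumes "CHAR('q::field) = CARD('p::prime_card)"
  shows "(fp_embed (s + t :: 'p mod_ring) :: 'q) = fp_embed s + fp_embed t"
  unfolding fp_embed_def to_int_mod_ring_add assms[symmetric] by simp

lemma fp_embed_mult:
  assumes "CHAR('q::field) = CARD('p::prime_card)"
  shows "(fp_embed (s * t :: 'p mod_ring) :: 'q) = fp_embed s * fp_embed t"
  unfolding fp_embed_def to_int_mod_ring_mult assms[symmetric] by simp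

lemma fp_embed_1: "(fp_embed (1 :: 'p::prime_card mod_ring) :: 'q::field) = 1"
  by (simp add: fp_embed_def)

lemma two_neq_zero_mod_ring: "odd CARD('p::prime_card) \<Longrightarrow> (2 :: 'p mod_ring) \<noteq> 0"
  using of_nat_0_mod_ring_dvd[of 2, where 'a = 'p] prime_card[where 'a = 'p]
  by (auto dest!: dvd_imp_le simp: prime_nat_iff) (metis le_antisym numeral_2_eq_2 Suc_leI even_numeral)

locale finite_field_over_prime =
  fixes prime_type :: "'p::prime_card itself" and field_type :: "'q::finite_field itself" and p e :: nat
  assumes p_def: "p = CARD('p)" and card_q: "CARD('q) = p ^ e"
begin

abbreviation emb :: "'p mod_ring \<Rightarrow> 'q" where "emb \<equiv> fp_embed"
abbreviation tr :: "'q \<Rightarrow> 'p mod_ring" where "tr \<equiv> fp_trace e"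

lemma card_q': "CARD('q) = CARD('p) ^ e"
  using card_q p_def by simp

lemmas char_q' = char_eq_card_mod_ring[OF card_q']

lemma char_q: "CHAR('q) = p"
  using char_q' p_def by simp

lemma p_gt_1: "p > 1"
  unfolding p_def by (rule prime_gt_1_nat[OF prime_card])

lemma e_pos: "e > 0"
proof (rule ccontr)
  assume "\<not> e > 0"
  then have "CARD('q) = 1"
    using card_q by simp
  moreover have "card {0, 1 :: 'q} \<le> CARD('q)"
    by (rule card_mono) auto
  ultimately show False
    by simp
qed

lemmas emb_add = fp_embed_add[OF char_q']
  and emb_mult = fp_embed_mult[OF char_q']
  and emb_eq_iff = inj_fp_embed[OF char_q', THEN inj_eq]
  and emb_tr = fp_embed_fp_trace[OF card_q', folded p_def]

lemma emb_0 [simp]: "emb 0 = 0"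
  by (simp add: fp_embed_def)

lemma emb_1 [simp]: "emb 1 = 1"
  by (simp add: fp_embed_1)

lemma emb_eq_0_iff [simp]: "emb t = 0 \<longleftrightarrow> t = 0"
  using emb_eq_iff[of t 0] by simp

lemma emb_power: "emb (t ^ n) = emb t ^ n"
  by (induction n) (simp_all add: emb_mult)

lemma emb_frobenius [simp]: "emb t ^ (p ^ k) = emb t"
proof -
  have "t ^ (p ^ k) = t"
    by (rule finite_field_power_card_power_eq_same) (simp add: p_def)
  then show ?thesis
    by (metis emb_power)
qed

lemma frobenius_add: "(x + y :: 'q) ^ (p ^ k) = x ^ (p ^ k) + y ^ (p ^ k)"
  using freshmans_dream'[of "p ^ k" k x y] char_q CHAR_prime[where 'a = 'q] by simp

lemma frobenius_sum: "(\<Sum>i\<in>A. f i :: 'q) ^ (p ^ k) = (\<Sum>i\<in>A. f i ^ (p ^ k))"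
  using p_gt_1 by (induction A rule: infinite_finite_induct) (simp_all add: frobenius_add power_0_left)

lemma frobenius_minus: "(- x :: 'q) ^ (p ^ k) = - (x ^ (p ^ k))"
proof -
  have "(- x) ^ (p ^ k) + x ^ (p ^ k) = 0"
    using frobenius_add[of "- x" x k] p_gt_1 by (simp add: power_0_left)
  then show ?thesis
    by (rule eq_neg_iff_add_eq_0[THEN iffD2])
qed

lemma frobenius_iterate: "(x ::'q) ^ (p ^ k) = x \<Longrightarrow> x ^ (p ^ (k * j)) = x"
  by (induction j) (simp_all add: power_add power_mult)

lemma frobenius_multiple_e: "(x ::'q) ^ (p ^ (e * j)) = x"
  by (rule finite_field_power_card_power_eq_same[of _ j]) (simp add: card_q power_mult)

text \<open>Identities for \<open>tr\<close> are checked after the injective \<open>emb\<close>,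
  where \<open>emb_tr\<close> turns the trace into the sum of conjugates.\<close>

lemma tr_add: "tr (x + y) = tr x + tr y"
proof -
  have "emb (tr (x + y)) = emb (tr x + tr y)"
    by (simp add: emb_tr emb_add frobenius_add sum.distrib)
  then show ?thesis
    by (simp add: emb_eq_iff)
qed

lemma tr_emb_mult: "tr (emb t * x) = t * tr x"
proof -
  have "emb (tr (emb t * x)) = emb (t * tr x)"
    by (simp add: emb_tr emb_mult power_mult_distrib sum_distrib_left)
  then show ?thesis
    by (simp add: emb_eq_iff)
qed

text \<open>The Frobenius power passes through the sum of conjugates, whose value lies in the prime
  field and is therefore fixed.\<close>

lemma tr_frobenius: "tr (x ^ (p ^ k)) = tr x"
proof -
  have "emb (tr (x ^ (p ^ k))) = (\<Sum>i<e. x ^ (p ^ i)) ^ (p ^ k)"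
    by (simp add: emb_tr frobenius_sum mult.commute flip: power_mult)
  also have "\<dots> = emb (tr x)"
    by (simp add: emb_tr[symmetric])
  finally show ?thesis
    by (simp add: emb_eq_iff)
qed

text \<open>The sum of conjugates is a polynomial of degree at most p^(e-1) < q whose linear
  coefficient is 1, so it cannot vanish on the whole field.\<close>

lemma tr_nonzero: "\<exists>x. tr x \<noteq> 0"
proof (rule ccontr)
  assume "\<not> ?thesis"
  then have zero: "(\<Sum>i<e. x ^ (p ^ i)) = 0" for x :: 'q
    using emb_tr[of x] by simp
  define f :: "'q poly" where "f = (\<Sum>i<e. Polynomial.monom 1 (p ^ i))"
  have "poly.coeff f 1 = (\<Sum>i<e. if i = 0 then 1 else 0)"
    unfolding f_def coeff_sum using p_gt_1 by (intro sum.cong) auto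
  then have "f \<noteq> 0"
    using e_pos by auto
  then have "card {x. poly f x = 0} \<le> degree f"
    by (rule card_poly_roots_bound)
  moreover have "{x. poly f x = 0} = UNIV"
    using zero by (simp add: f_def poly_sum poly_monom)
  moreover have "degree f \<le> p ^ (e - 1)"
    unfolding f_def
  proof (rule degree_sum_le)
    fix i
    assume "i \<in> {..<e}"
    then have "p ^ i \<le> p ^ (e - 1)"
      using p_gt_1 by (intro power_increasing) auto
    then show "degree (Polynomial.monom (1::'q) (p ^ i)) \<le> p ^ (e - 1)"
      by (simp add: degree_monom_eq)
  qed simp
  moreover have "p ^ (e - 1) < p ^ e"
    using p_gt_1 e_pos by (intro power_strict_increasing) auto
  ultimately show False
    using card_q by simp
qed

end

section \<open>Power residues and roots of unity in the cyclic multiplicative group\<close>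

lemma finite_field_generator:
  obtains g :: "'q::finite_field"
  where "g \<noteq> 0" "\<And>x. x \<noteq> 0 \<Longrightarrow> \<exists>j < CARD('q) - 1. x = g ^ j"
    "\<And>i. g ^ i = 1 \<longleftrightarrow> (CARD('q) - 1) dvd i"
proof -
  let ?n = "CARD('q) - 1"
  have "\<exists>a\<in>carrier (mult_of (class_ring :: 'q ring)).
      carrier (mult_of (class_ring :: 'q ring)) = {a [^]\<^bsub>(class_ring :: 'q ring)\<^esub> i |i. i \<in> (UNIV :: nat set)}"
    by (rule field.finite_field_mult_group_has_gen[OF class_field]) simp
  then obtain g :: 'q where g: "g \<noteq> 0" and gen: "UNIV - {0} = {g ^ i |i. i \<in> (UNIV :: nat set)}"
    by (auto simp: class_ring_simps carrier_mult_of)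
  have n: "?n > 0"
  proof -
    have "card {0, 1 :: 'q} \<le> CARD('q)"
      by (rule card_mono) auto
    then show ?thesis
      by simp
  qed
  have "g * g ^ ?n = g * 1"
    using finite_field_power_card_eq_same[of g] n by (simp flip: power_Suc)
  then have g1: "g ^ ?n = 1"
    using g by simp
  have mod: "g ^ i = g ^ (i mod ?n)" for i
  proof -
    have "g ^ i = g ^ (?n * (i div ?n) + i mod ?n)"
      by simp
    also have "\<dots> = g ^ (i mod ?n)"
      unfolding power_add power_mult g1 by simp
    finally show ?thesis .
  qed
  have "(\<lambda>j. g ^ j) ` {..<?n} = UNIV - {0}"
  proof (intro equalityI subsetI)
    fix x :: 'q
    assume "x \<in> UNIV - {0}"
    then obtain i where "x = g ^ i"
      using gen by blast
    then show "x \<in> (\<lambda>j. g ^ j) ` {..<?n}"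
      using mod[of i] n by (intro image_eqI[of _ _ "i mod ?n"]) auto
  qed (use g in auto)
  \<comment> \<open>A surjection between finite sets of equal size is injective; this makes the
    order of \<open>g\<close> exactly \<open>?n\<close>.\<close>
  moreover from this have "inj_on (\<lambda>j. g ^ j) {..<?n}"
    by (intro eq_card_imp_inj_on) (simp_all add: card_Diff_singleton)
  ultimately have img: "(\<lambda>j. g ^ j) ` {..<?n} = UNIV - {0}" and inj: "inj_on (\<lambda>j. g ^ j) {..<?n}"
    by blast+
  have "g ^ i = 1 \<longleftrightarrow> ?n dvd i" for i
  proof
    assume "g ^ i = 1"
    then have "g ^ (i mod ?n) = g ^ 0"
      using mod[of i] by simp
    then have "i mod ?n = 0"
      using inj_onD[OF inj, of "i mod ?n" 0] n by simp
    then show "?n dvd i"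
      by auto
  next
    assume "?n dvd i"
    then obtain c where "i = ?n * c" ..
    then show "g ^ i = 1"
      by (simp only: power_mult g1 power_one)
  qed
  then show thesis
    using that[OF g] img by blast
qed

text \<open>For z = g^j the hypothesis says that k n divides j n, so j is a multiple of k.\<close>

lemma finite_field_power_residue:
  fixes z :: "'q::finite_field"
  assumes z: "z \<noteq> 0" and q: "CARD('q) - 1 = k * n" and n: "z ^ n = 1"
  obtains y where "y ^ k = z"
proof -
  obtain g :: 'q where g: "g \<noteq> 0" "\<And>x. x \<noteq> 0 \<Longrightarrow> \<exists>j < CARD('q) - 1. x = g ^ j"
    "\<And>i. g ^ i = 1 \<longleftrightarrow> (CARD('q) - 1) dvd i"
    using finite_field_generator[where 'q = 'q] by metis
  obtain j where j: "z = g ^ j" "j < k * n"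
    using g(2)[OF z] q by auto
  then have "k * n dvd j * n"
    using n g(3)[of "j * n"] q by (simp add: power_mult)
  then have "k dvd j"
    using j by (cases "n = 0") auto
  then obtain i where "j = i * k"
    by (metis dvdE mult.commute)
  then have "(g ^ i) ^ k = z"
    by (simp add: j power_mult)
  then show thesis
    by (rule that)
qed

lemma finite_field_card_roots_of_unity:
  assumes q: "CARD('q::finite_field) - 1 = k * n"
  shows "card {x::'q. x ^ k = 1} = k"
proof -
  obtain g :: 'q where g: "g \<noteq> 0" "\<And>x. x \<noteq> 0 \<Longrightarrow> \<exists>j < CARD('q) - 1. x = g ^ j"
    "\<And>i. g ^ i = 1 \<longleftrightarrow> (CARD('q) - 1) dvd i"
    using finite_field_generator[where 'q = 'q] by metis
  have "k * n > 0"
  proof -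
    have "card {0, 1 :: 'q} \<le> CARD('q)"
      by (rule card_mono) auto
    then show ?thesis
      unfolding q[symmetric] by simp
  qed
  then have k: "k > 0" and n: "n > 0"
    by simp_all
  have eq: "{x::'q. x ^ k = 1} = (\<lambda>i. g ^ (n * i)) ` {..<k}"
  proof (intro equalityI subsetI)
    fix x :: 'q
    assume "x \<in> {x. x ^ k = 1}"
    then have xk: "x ^ k = 1"
      by simp
    then have "x \<noteq> 0"
      using k by (auto simp: power_0_left)
    then obtain j where j: "x = g ^ j" "j < k * n"
      using g(2) q by auto
    then have "n * k dvd j * k"
      using xk g(3)[of "j * k"] q by (simp add: power_mult mult.commute)
    then obtain i where "j = n * i"
      using k by auto
    then show "x \<in> (\<lambda>i. g ^ (n * i)) ` {..<k}"
      using j n by auto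
  next
    fix x :: 'q
    assume "x \<in> (\<lambda>i. g ^ (n * i)) ` {..<k}"
    then obtain i where "x = g ^ (n * i)"
      by blast
    then have "x ^ k = g ^ (k * n * i)"
      by (simp add: mult_ac flip: power_mult)
    then show "x \<in> {x. x ^ k = 1}"
      using g(3)[of "k * n * i"] q by simp
  qed
  have "inj_on (\<lambda>i. g ^ (n * i)) {..<k}"
  proof (rule linorder_inj_onI)
    fix i j
    assume ij: "i < j" "i \<in> {..<k}" "j \<in> {..<k}"
    show "g ^ (n * i) \<noteq> g ^ (n * j)"
    proof
      assume "g ^ (n * i) = g ^ (n * j)"
      moreover have "n * j = n * i + n * (j - i)"
        using ij by (simp flip: distrib_left)
      ultimately have "g ^ (n * i) * g ^ (n * (j - i)) = g ^ (n * i) * 1"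
        by (simp only: power_add) simp
      then have "g ^ (n * (j - i)) = 1"
        using g(1) by simp
      then have "n * k dvd n * (j - i)"
        using g(3) q by (simp add: mult.commute)
      then have "k dvd j - i"
        using n by simp
      then show False
        using ij by (auto dest: dvd_imp_le)
    qed
  qed auto
  then show ?thesis
    by (simp add: eq card_image)
qed

section \<open>The quadratic form \<open>Tr (x ^ (p ^ \<alpha> + 1))\<close>\<close>

locale trace_form = finite_field_over_prime prime_type field_type p e
  for prime_type :: "'p::prime_card itself" and field_type :: "'q::finite_field itself" and p e :: nat +
  fixes m \<alpha> d :: nat
  assumes odd_p: "odd p" and m_pos: "m > 0" and e_def: "e = 2 * m"
    and d_def: "d = gcd \<alpha> e" and d_dvd_m: "d dvd m" and odd_m_div_d: "odd (m div d)"
begin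

definition form :: "'q \<Rightarrow> 'p mod_ring" where
  "form x = tr (x ^ (p ^ \<alpha> + 1))"

definition polar :: "'q \<Rightarrow> 'q \<Rightarrow> 'p mod_ring" where
  "polar x y = tr (x ^ (p ^ \<alpha>) * y + x * y ^ (p ^ \<alpha>))"

text \<open>The power \<open>p ^ (\<alpha> * (e - 1))\<close> inverts the Frobenius power \<open>p ^ \<alpha>\<close>, so \<open>adj\<close> represents
  the functionals \<open>polar x\<close> by the trace pairing.\<close>
definition adj :: "'q \<Rightarrow> 'q" where
  "adj x = x ^ (p ^ \<alpha>) + x ^ (p ^ (\<alpha> * (e - 1)))"

lemma d_pos: "d > 0"
  using d_def e_pos by (simp add: gcd_pos_nat)

lemma two_mod_ring: "(2 :: 'p mod_ring) \<noteq> 0"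
  using odd_p p_def two_neq_zero_mod_ring[where 'p = 'p] by simp

lemma two_q: "(2 :: 'q) \<noteq> 0"
proof -
  have "emb 2 = 2"
    using emb_add[of 1 1] by simp
  then show ?thesis
    using two_mod_ring emb_eq_0_iff[of 2] by metis
qed

lemma frobenius_alpha_inverse: "((x::'q) ^ (p ^ (\<alpha> * (e - 1)))) ^ (p ^ \<alpha>) = x"
proof -
  have "\<alpha> * (e - 1) + \<alpha> = e * \<alpha>"
    using e_pos by (cases e) auto
  moreover have "(x ^ (p ^ (\<alpha> * (e - 1)))) ^ (p ^ \<alpha>) = x ^ (p ^ (\<alpha> * (e - 1) + \<alpha>))"
    by (simp only: power_add power_mult)
  ultimately show ?thesis
    by (simp only: frobenius_multiple_e)
qed

text \<open>Invariance of the trace moves the Frobenius power off \<open>y\<close> and onto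
  \<open>x\<close>, as its inverse.\<close>

lemma polar_eq_tr_adj: "polar x y = tr (adj x * y)"
proof -
  have "tr (x * y ^ (p ^ \<alpha>)) = tr ((x ^ (p ^ (\<alpha> * (e - 1))) * y) ^ (p ^ \<alpha>))"
    unfolding power_mult_distrib frobenius_alpha_inverse ..
  then show ?thesis
    by (simp add: polar_def adj_def tr_add tr_frobenius distrib_right)
qed

lemma adj_add: "adj (x + y) = adj x + adj y"
  by (simp add: adj_def frobenius_add)

text \<open>An odd power of \<open>x \<mapsto> x ^ (p ^ (2 * \<alpha>))\<close> is the identity, which excludes the
  eigenvalue \<open>-1\<close>.\<close>
lemma adj_eq_0_imp:
  assumes "adj x = 0"
  shows "x = 0"
proof -
  have "(x ^ (p ^ \<alpha>)) ^ (p ^ \<alpha>) + x = (adj x) ^ (p ^ \<alpha>)"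
    unfolding adj_def frobenius_add frobenius_alpha_inverse ..
  also have "\<dots> = 0"
    using assms p_gt_1 by simp
  finally have neg: "x ^ (p ^ (2 * \<alpha>)) = - x"
    by (simp add: eq_neg_iff_add_eq_0 mult_2 power_add power_mult)
  have iter: "x ^ (p ^ (2 * \<alpha> * j)) = (- 1) ^ j * x" for j
  proof (induction j)
    case (Suc j)
    have "x ^ (p ^ (2 * \<alpha> * Suc j)) = (x ^ (p ^ (2 * \<alpha>))) ^ (p ^ (2 * \<alpha> * j))"
      by (simp add: power_add mult_ac flip: power_mult)
    also have "\<dots> = - ((- 1) ^ j * x)"
      unfolding neg frobenius_minus Suc.IH ..
    finally show ?case
      by simp
  qed simp
  obtain w where w: "\<alpha> = d * w"
    using d_def by (metis gcd_dvd1 dvdE)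
  \<comment> \<open>As e = 2 m, iterating the 2 \<alpha>-fold Frobenius m / d times amounts to w
    full turns, hence to the identity.\<close>
  have "2 * \<alpha> * (m div d) = e * w"
    using d_dvd_m d_pos by (simp add: w e_def)
  then have "x = (- 1) ^ (m div d) * x"
    using iter[of "m div d"] frobenius_multiple_e[of x w] by simp
  then have "2 * x = 0"
    using odd_m_div_d by simp
  then show ?thesis
    using two_q by simp
qed

lemma bij_adj: "bij adj"
proof -
  have "adj x = adj y \<Longrightarrow> x = y" for x y
    using adj_add[of "x - y" y] adj_eq_0_imp[of "x - y"] by simp
  then have "inj adj"
    by (rule injI)
  then show ?thesis
    by (simp add: bij_def finite_UNIV_inj_surj)
qed

sublocale quadratic_space "\<lambda>t x. emb t * x" form polar
proof unfold_locales
  show "(2 :: 'p mod_ring) \<noteq> 0"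
    by (rule two_mod_ring)
  show "form (emb t * x) = t\<^sup>2 * form x" for t x
  proof -
    have "(emb t * x) ^ (p ^ \<alpha> + 1) = emb (t\<^sup>2) * x ^ (p ^ \<alpha> + 1)"
      by (simp add: power_mult_distrib emb_mult power2_eq_square mult_ac)
    then show ?thesis
      unfolding form_def by (simp only: tr_emb_mult)
  qed
  show "form (x + y) = form x + form y + polar x y" for x y
    unfolding form_def polar_def tr_add[symmetric]
    by (simp add: frobenius_add algebra_simps)
  show "polar x (y + z) = polar x y + polar x z" for x y z
    unfolding polar_eq_tr_adj by (simp add: distrib_left tr_add)
  show "polar x (emb t * y) = t * polar x y" for x t y
    unfolding polar_eq_tr_adj by (metis tr_emb_mult mult.left_commute)
  show "\<exists>y. polar x y \<noteq> 0" if "x \<noteq> 0" for x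
  proof -
    obtain z where "tr z \<noteq> 0"
      using tr_nonzero by blast
    moreover have "adj x \<noteq> 0"
      using adj_eq_0_imp that by blast
    ultimately have "polar x (z / adj x) \<noteq> 0"
      unfolding polar_eq_tr_adj by simp
    then show ?thesis ..
  qed
qed (simp_all add: distrib_left distrib_right emb_add emb_mult)

text \<open>Since \<open>\<alpha>\<close> is an odd multiple of \<open>d\<close>, raising to \<open>p ^ \<alpha> + 1\<close> and to \<open>p ^ d + 1\<close> agree on
  the subfield with \<open>p ^ (2 * d)\<close> elements.\<close>
lemma power_norm:
  assumes y: "y ^ (p ^ d + 1) = emb t" and t: "t \<noteq> 0"
  shows "y ^ (p ^ \<alpha> + 1) = emb t"
proof -
  have "emb t * emb t ^ (p ^ d - 1) = emb t"
    using emb_frobenius[of t d] p_gt_1 by (simp flip: power_Suc)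
  then have one: "emb t ^ (p ^ d - 1) = 1"
    using t by simp
  \<comment> \<open>This exponent splits \<open>y ^ (p ^ (d * 2))\<close> into y times a (p^d -
    1)-th power of \<open>emb t\<close>, which is 1.\<close>
  have "p ^ (d * 2) = (p ^ d + 1) * (p ^ d - 1) + 1"
    using p_gt_1 by (simp add: power_mult power2_eq_square algebra_simps)
  then have fix2: "y ^ (p ^ (d * 2)) = y"
    using y one by (simp only: power_add power_mult) simp
  obtain w where w: "\<alpha> = d * w"
    using d_def by (metis gcd_dvd1 dvdE)
  \<comment> \<open>If w were even, 2 d would divide both \<alpha> and e = 2 m, contradicting the
    choice of d as their gcd.\<close>
  have "odd w"
  proof
    assume "even w"
    then have "d * 2 dvd \<alpha>"
      by (simp add: w)
    moreover have "d * 2 dvd e"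
      using d_dvd_m by (simp add: e_def mult.commute)
    ultimately have "d * 2 dvd d"
      unfolding d_def by simp
    then show False
      using d_pos by (auto dest: dvd_imp_le)
  qed
  then obtain j where "w = 2 * j + 1"
    by (rule oddE)
  then have "\<alpha> = d + d * 2 * j"
    by (simp add: w algebra_simps)
  then have "y ^ (p ^ \<alpha>) = (y ^ (p ^ (d * 2 * j))) ^ (p ^ d)"
    by (simp add: power_add mult.commute flip: power_mult)
  also have "\<dots> = y ^ (p ^ d)"
    by (simp add: frobenius_iterate[OF fix2])
  finally show ?thesis
    using y by simp
qed

text \<open>p - 1 divides p^d - 1, and p^(2d) - 1 divides p^e - 1 because d divides m. The factor
  p^d + 1 provides the roots of unity; the factor p - 1 makes nonzero elements of \<open>F_p\<close>
  into (p^d + 1)-th powers.\<close>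

lemma card_q_minus_1:
  obtains n where "CARD('q) - 1 = (p ^ d + 1) * ((p - 1) * n)"
proof -
  obtain u where u: "m = d * u"
    using d_dvd_m by auto
  have "int p - 1 dvd int p ^ d - 1"
    by (simp add: power_diff_1_eq)
  then have "(int p ^ d + 1) * (int p - 1) dvd (int p ^ d + 1) * (int p ^ d - 1)"
    by (rule mult_dvd_mono[OF dvd_refl])
  also have "\<dots> = int p ^ (2 * d) - 1"
    by (simp add: algebra_simps power_mult power2_eq_square mult_2 power_add)
  also have "\<dots> dvd (int p ^ (2 * d)) ^ u - 1"
    by (simp add: power_diff_1_eq)
  also have "\<dots> = int CARD('q) - 1"
    by (simp add: card_q e_def u mult_ac flip: power_mult)
  also have "\<dots> = int (CARD('q) - 1)"
    using card_q p_gt_1 by (simp add: of_nat_diff)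
  finally have "(int p ^ d + 1) * (int p - 1) dvd int (CARD('q) - 1)" .
  moreover have "(int p ^ d + 1) * (int p - 1) = int ((p ^ d + 1) * (p - 1))"
  proof -
    have "int (p - 1) = int p - 1"
      using p_gt_1 by simp
    then show ?thesis
      by (simp only: of_nat_mult of_nat_add of_nat_power of_nat_1)
  qed
  ultimately have "(p ^ d + 1) * (p - 1) dvd CARD('q) - 1"
    by (simp only: of_nat_dvd_iff)
  then show thesis
    using that by (metis dvdE mult.assoc)
qed

text \<open>The order of \<open>emb t\<close> divides p - 1, so \<open>emb t\<close> is a (p^d +
  1)-th power y^(p^d + 1); by \<open>power_norm\<close>, multiplication by this y scales the form by
  t, be t a square or not.\<close>

lemma level_scale:
  assumes t: "t \<noteq> 0"
  shows "level t = level 1"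
proof -
  obtain n where n: "CARD('q) - 1 = (p ^ d + 1) * ((p - 1) * n)"
    by (rule card_q_minus_1)
  have "emb t * emb t ^ (p - 1) = emb t"
    using emb_frobenius[of t 1] p_gt_1 by (simp flip: power_Suc)
  then have "emb t ^ (p - 1) = 1"
    using t by simp
  then have "emb t ^ ((p - 1) * n) = 1"
    by (simp add: power_mult)
  then obtain y where "y ^ (p ^ d + 1) = emb t"
    using finite_field_power_residue[OF _ n, of "emb t"] t by auto
  then have y: "y ^ (p ^ \<alpha> + 1) = emb t"
    using t by (rule power_norm)
  have form: "form (y * x) = t * form x" for x
    unfolding form_def power_mult_distrib y tr_emb_mult ..
  have "y \<noteq> 0"
    using y t by auto
  show ?thesis
  proof (rule card_bij_Collect)
    show "bij ((*) y)"
      using \<open>y \<noteq> 0\<close> by (intro o_bij[of "\<lambda>x. x / y"]) (auto simp: fun_eq_iff)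
    show "form (y * x) = t \<longleftrightarrow> form x = 1" for x
      using t by (simp add: form)
  qed
qed

text \<open>The roots of unity of order \<open>p ^ d + 1\<close> act freely on the nonzero level sets.\<close>
lemma dvd_level: "p ^ d + 1 dvd level 1"
proof -
  let ?k = "p ^ d + 1"
  let ?S = "{x. form x = 1}"
  obtain n where n: "CARD('q) - 1 = ?k * ((p - 1) * n)"
    by (rule card_q_minus_1)
  \<comment> \<open>The orbits are the fibres of the (p^d + 1)-th power map. Each is a full coset of
    the roots of unity, as 0 does not lie in the level set.\<close>
  have fibre: "card {x \<in> ?S. x ^ ?k = w} = ?k" if w: "w \<in> (\<lambda>x. x ^ ?k) ` ?S" for w
  proof -
    obtain x0 where x0: "form x0 = 1" "w = x0 ^ ?k"
      using w by blast
    then have nz: "x0 \<noteq> 0"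
      using Q_zero by auto
    have "{x \<in> ?S. x ^ ?k = w} = (\<lambda>u. x0 * u) ` {u. u ^ ?k = 1}"
    proof (intro equalityI subsetI)
      fix x
      assume "x \<in> {x \<in> ?S. x ^ ?k = w}"
      then have "(x / x0) ^ ?k = 1"
        using nz x0 by (simp add: power_divide)
      then show "x \<in> (\<lambda>u. x0 * u) ` {u. u ^ ?k = 1}"
        using nz by (intro image_eqI[of _ _ "x / x0"]) auto
    next
      fix x
      assume "x \<in> (\<lambda>u. x0 * u) ` {u. u ^ ?k = 1}"
      then obtain u where u: "x = x0 * u" "u ^ ?k = 1"
        by blast
      then have "u ^ (p ^ \<alpha> + 1) = 1"
        using power_norm[of u 1] by simp
      then have "form x = 1"
        using x0 unfolding form_def u(1) power_mult_distrib by simp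
      moreover have "x ^ ?k = w"
        unfolding u(1) power_mult_distrib u(2) x0(2) by simp
      ultimately show "x \<in> {x \<in> ?S. x ^ ?k = w}"
        by simp
    qed
    then have "card {x \<in> ?S. x ^ ?k = w} = card {u::'q. u ^ ?k = 1}"
      using nz by (simp add: card_image inj_on_def)
    then show ?thesis
      using finite_field_card_roots_of_unity[OF n] by simp
  qed
  have "level 1 = (\<Sum>w\<in>(\<lambda>x. x ^ ?k) ` ?S. card {x \<in> ?S. x ^ ?k = w})"
    using sum.image_gen[of ?S "\<lambda>_. 1::nat" "\<lambda>x. x ^ ?k"] by simp
  also have "\<dots> = (\<Sum>w\<in>(\<lambda>x. x ^ ?k) ` ?S. ?k)"
    by (rule sum.cong[OF refl fibre])
  finally show ?thesis
    by (simp only: sum_constant of_nat_id dvd_triv_right)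
qed

lemma card_q_eq: "int CARD('q) = int CARD('p mod_ring) * int p ^ (e - 1)"
proof -
  have "e = Suc (e - 1)"
    using e_pos by simp
  then show ?thesis
    by (metis CARD_mod_ring card_q of_nat_power p_def power_Suc)
qed

lemma power_e_minus_1: "int p ^ (e - 1) = int CARD('p mod_ring) * int p ^ (e - 2)"
proof -
  have "e - 1 = Suc (e - 2)"
    using m_pos e_def by simp
  then show ?thesis
    by (metis CARD_mod_ring p_def power_Suc)
qed

text \<open>The wrong sign would give \<open>level 1\<close> the value p^(m-1) (p^m - 1). Then p^d +
  1, being prime to p, would divide both p^m - 1 and p^m + 1, hence 2.\<close>

lemma level_1: "int (level 1) = int p ^ (e - 1) + int p ^ (m - 1)"
proof -
  \<comment> \<open>The locale is entered with a still unknown deficit, only to obtain its square;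
    the later sublocale fixes the value.\<close>
  define \<delta> where "\<delta> = int p ^ (e - 1) - int (level 1)"
  interpret E: equidistributed_quadratic_space "\<lambda>t x. emb t * x" form polar "level 1"
    "int p ^ (e - 1)" "int p ^ (e - 2)" \<delta>
    by unfold_locales (erule level_scale, rule card_q_eq, rule power_e_minus_1, simp add: \<delta>_def)
  have "e - 2 = (m - 1) * 2"
    using e_def by simp
  then have "\<delta>\<^sup>2 = (int p ^ (m - 1))\<^sup>2"
    using E.delta_square by (simp flip: power_mult)
  then have "\<delta> = int p ^ (m - 1) \<or> \<delta> = - (int p ^ (m - 1))"
    by (simp add: power2_eq_iff)
  moreover have "\<delta> \<noteq> int p ^ (m - 1)"
  proof
    assume \<delta>: "\<delta> = int p ^ (m - 1)"
    have "e - 1 = (m - 1) + m"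
      using m_pos e_def by simp
    then have "int (level 1) = int p ^ (m - 1) * (int p ^ m - 1)"
      using \<delta> by (simp add: \<delta>_def power_add algebra_simps)
    moreover have "int p ^ d + 1 dvd int (level 1)"
      using dvd_level[THEN of_nat_dvd_iff[where 'a = int, THEN iffD2]] by (simp add: add.commute)
    ultimately have "int p ^ d + 1 dvd int p ^ (m - 1) * (int p ^ m - 1)"
      by (simp only:)
    moreover have "coprime (int p ^ d + 1) (int p ^ (m - 1))"
    proof -
      have "coprime (int p) (int p ^ d + 1)"
      proof (rule coprimeI)
        fix c
        assume c: "c dvd int p" "c dvd int p ^ d + 1"
        then have "c dvd int p ^ d"
          using d_pos by (meson dvd_power dvd_trans)
        then show "is_unit c"
          using c(2) by (simp add: dvd_add_right_iff)
      qed
      then show ?thesis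
        by (simp add: coprime_commute)
    qed
    ultimately have "int p ^ d + 1 dvd int p ^ m - 1"
      by (simp add: coprime_dvd_mult_right_iff)
    moreover have "int p ^ d + 1 dvd int p ^ m + 1"
    proof -
      obtain u where u: "m = d * u"
        using d_dvd_m by auto
      then have "odd u"
        using odd_m_div_d d_pos by simp
      have "int p ^ d - (- 1) dvd (int p ^ d) ^ u - (- 1) ^ u"
        unfolding power_diff_sumr2 by (rule dvd_triv_left)
      then show ?thesis
        using \<open>odd u\<close> by (simp add: u power_mult)
    qed
    ultimately have "int p ^ d + 1 dvd (int p ^ m + 1) - (int p ^ m - 1)"
      by (metis dvd_diff)
    then have "int p ^ d + 1 \<le> 2"
      by (auto dest: zdvd_imp_le)
    moreover have "int p \<le> int p ^ d"
      using p_gt_1 d_pos by (intro self_le_power) auto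
    ultimately show False
      using p_gt_1 by linarith
  qed
  ultimately show ?thesis
    by (auto simp: \<delta>_def)
qed

text \<open>The deficit is negative, whence the minus signs before the Legendre symbols in the
  exponents of the enumerator.\<close>

sublocale equidistributed_quadratic_space "\<lambda>t x. emb t * x" form polar "level 1"
  "int p ^ (e - 1)" "int p ^ (e - 2)" "- (int p ^ (m - 1))"
  by unfold_locales (erule level_scale, rule card_q_eq, rule power_e_minus_1, simp add: level_1)

end

section \<open>The trace code\<close>

lemma legendre_symbol_eq_qchar: "legendre_symbol (x :: 'p::prime_card mod_ring) = qchar x"
proof -
  let ?r = "of_int :: int \<Rightarrow> 'p mod_ring"
  have x: "?r (to_int_mod_ring x) = x"
    by (simp add: of_int_of_int_mod_ring)
  have cong: "[y = z] (mod int CARD('p)) \<longleftrightarrow> ?r y = ?r z" for y z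
    by (simp add: of_int_eq_iff_cong_CHAR)
  have "(\<exists>y. [y\<^sup>2 = to_int_mod_ring x] (mod int CARD('p))) \<longleftrightarrow> (\<exists>w. w\<^sup>2 = x)"
    unfolding cong x of_int_power by (metis of_int_mod_ring_to_int_mod_ring of_int_of_int_mod_ring)
  then show ?thesis
    by (simp add: legendre_symbol_def Legendre_def QuadRes_def qchar_def cong x)
qed

text \<open>Coordinates with respect to a basis \<open>A\<close> identify the space with the
  functions from \<open>A\<close> to the scalars.\<close>

lemma (in vectorspace) card_carrier_eq_power_dim:
  assumes "finite (carrier V)"
  shows "card (carrier V) = card (carrier K) ^ dim"
proof -
  have "carrier V \<subseteq> span (carrier V)" "span (carrier V) \<subseteq> carrier V"
    by (rule in_own_span, rule subset_refl) (rule span_is_subset2, rule subset_refl)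
  then have "fin_dim"
    unfolding fin_dim_def using assms by blast
  then obtain A where A: "finite A" "basis A"
    using finite_basis_exists by blast
  then have AV: "A \<subseteq> carrier V"
    by (simp add: basis_def)
  have crit: "\<And>v. v \<in> carrier V \<Longrightarrow> \<exists>!f. f \<in> A \<rightarrow>\<^sub>E carrier K \<and> lincomb f A = v"
    using basis_criterion[OF A(1) AV] A(2) by simp
  have closed: "lincomb f A \<in> carrier V" if "f \<in> A \<rightarrow>\<^sub>E carrier K" for f
    using that by (intro lincomb_closed[OF AV]) (simp add: PiE_iff Pi_iff)
  have "bij_betw (\<lambda>f. lincomb f A) (A \<rightarrow>\<^sub>E carrier K) (carrier V)"
    unfolding bij_betw_def
  proof
    show "inj_on (\<lambda>f. lincomb f A) (A \<rightarrow>\<^sub>E carrier K)"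
      using crit closed by (intro inj_onI) metis
    show "(\<lambda>f. lincomb f A) ` (A \<rightarrow>\<^sub>E carrier K) = carrier V"
      using crit closed by blast
  qed
  then show ?thesis
    using A dim_basis by (simp add: card_PiE flip: bij_betw_same_card)
qed

text \<open>Over a finite field the dimension can be read off the cardinality, so no basis of the
  code has to be exhibited.\<close>

lemma linear_code_cardI:
  fixes C :: "'a::{field,finite} vec set"
  assumes sub: "submodule class_ring C (module_vec TYPE('a) n)" and card: "card C = CARD('a) ^ k"
  shows "linear_code n k C"
proof -
  interpret V: vectorspace class_ring "module_vec TYPE('a) n"
    by (rule vec_vs)
  have sp: "subspace class_ring C (module_vec TYPE('a) n)"
    using sub by (simp add: subspace_def V.vectorspace_axioms)
  interpret W: vectorspace class_ring "module_vec TYPE('a) n\<lparr>carrier := C\<rparr>"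
    by (rule V.subspace_is_vs[OF sp])
  have "finite C"
    using card by (intro card_ge_0_finite) simp
  then have "CARD('a) ^ W.dim = CARD('a) ^ k"
    using W.card_carrier_eq_power_dim card by simp
  moreover have "CARD('a) > 1"
  proof -
    have "card {0, 1 :: 'a} \<le> CARD('a)"
      by (rule card_mono) auto
    then show ?thesis
      by simp
  qed
  ultimately have "W.dim = k"
    by simp
  then show ?thesis
    using sp by (simp add: linear_code_def)
qed

text \<open>A codeword influences weights and enumerator only through the class of \<open>x\<close>:
  zero, isotropic, or a nonzero value of \<open>Q\<close>. The ring is general to serve rational
  multiplicities as well as polynomials.\<close>

lemma (in equidistributed_quadratic_space) sum_by_level:
  fixes f :: "'v \<Rightarrow> 'r::comm_ring_1"
  assumes f0: "f 0 = u" and fiso: "\<And>x. x \<noteq> 0 \<Longrightarrow> Q x = 0 \<Longrightarrow> f x = A"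
    and faniso: "\<And>x. Q x \<noteq> 0 \<Longrightarrow> f x = T (Q x)"
  shows "(\<Sum>x\<in>UNIV. f x) = u + (of_int k + (of_nat CARD('k) - 1) * of_int \<delta> - 1) * A
    + (of_int k - of_int \<delta>) * (\<Sum>s | s \<noteq> 0. T s)"
proof -
  have "(\<Sum>x\<in>UNIV. f x) = (\<Sum>s\<in>UNIV. \<Sum>x | Q x = s. f x)"
    using sum.group[of UNIV UNIV Q f] by simp
  also have "\<dots> = (\<Sum>x | Q x = 0. f x) + (\<Sum>s | s \<noteq> 0. \<Sum>x | Q x = s. f x)"
    by (subst sum.remove[of _ 0]) (auto intro!: sum.cong arg_cong2[where f = "(+)"])
  also have "(\<Sum>s | s \<noteq> 0. \<Sum>x | Q x = s. f x) = (\<Sum>s | s \<noteq> 0. of_nat M * T s)"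
  proof (rule sum.cong[OF refl])
    fix s :: 'k
    assume "s \<in> {s. s \<noteq> 0}"
    then have s: "s \<noteq> 0"
      by simp
    then have "(\<Sum>x | Q x = s. f x) = (\<Sum>x | Q x = s. T s)"
      by (intro sum.cong) (auto simp: faniso)
    then show "(\<Sum>x | Q x = s. f x) = of_nat M * T s"
      by (simp add: level_eq[OF s])
  qed
  also have "\<dots> = of_nat M * (\<Sum>s | s \<noteq> 0. T s)"
    by (rule sum_distrib_left[symmetric])
  also have "(\<Sum>x | Q x = 0. f x) = u + (\<Sum>x\<in>{x. Q x = 0} - {0}. f x)"
    by (subst sum.remove[of _ 0]) (auto simp: f0)
  also have "(\<Sum>x\<in>{x. Q x = 0} - {0}. f x) = (\<Sum>x\<in>{x. Q x = 0} - {0}. A)"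
    by (intro sum.cong) (auto simp: fiso)
  also have "\<dots> = of_nat (level 0 - 1) * A"
    by (simp add: card_Diff_singleton)
  also have "level 0 \<ge> 1"
  proof -
    have "card {0 :: 'v} \<le> level 0"
      by (rule card_mono) auto
    then show ?thesis
      by simp
  qed
  then have "(of_nat (level 0 - 1) :: 'r) = of_int (int (level 0) - 1)"
    by (simp add: of_nat_diff)
  also have "\<dots> = of_int k + (of_nat CARD('k) - 1) * of_int \<delta> - 1"
    by (simp add: level_zero)
  also have "(of_nat M :: 'r) = of_int k - of_int \<delta>"
    using M_eq by (metis of_int_diff of_int_of_nat_eq)
  finally show ?thesis .
qed

section \<open>Codewords, their span and its dimension\<close>

locale trace_code = trace_form prime_type field_type p e m \<alpha> d
  for prime_type :: "'p::prime_card itself" and field_type :: "'q::finite_field itself"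
    and p e m \<alpha> d :: nat +
  fixes a :: "'p mod_ring" and ds :: "'q list"
  assumes a_nz: "a \<noteq> 0" and distinct_ds: "distinct ds" and set_ds: "set ds = {y. form y = a}"
begin

text \<open>Indexing by \<open>polar x\<close> instead of the trace pairing with \<open>x\<close>
  only permutes the words, by \<open>adj\<close>, and turns coordinate counts into section
  counts.\<close>

definition word :: "'p mod_ring \<Rightarrow> 'q \<Rightarrow> 'p mod_ring vec" where
  "word b x = vec (length ds) (\<lambda>k. polar x (ds ! k) + b)"

lemma dim_word [simp]: "dim_vec (word b x) = length ds"
  by (simp add: word_def)

lemma shifted_trace_code_eq: "shifted_trace_code e ds b = range (word b)"
proof -
  have "shifted_trace_code e ds b = (\<lambda>x. vec (length ds) (\<lambda>k. tr (x * ds ! k) + b)) ` range adj"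
    using bij_adj by (auto simp: shifted_trace_code_def bij_def)
  then show ?thesis
    by (simp add: word_def polar_eq_tr_adj image_image)
qed

lemma length_ds: "length ds = level a"
  using distinct_card[OF distinct_ds] set_ds by simp

lemma length_ds_eq: "length ds = p ^ (e - 1) + p ^ (m - 1)"
proof -
  have "int (length ds) = int p ^ (e - 1) + int p ^ (m - 1)"
    using level_scale[OF a_nz] level_1 by (simp add: length_ds)
  then show ?thesis
    by (metis of_nat_add of_nat_eq_iff of_nat_power)
qed

lemma coord_count_word: "coord_count (word b x) i = section_count x a (i - b)"
proof -
  have "bij_betw ((!) ds) {..<length ds} (set ds)"
    by (rule bij_betw_nth[OF distinct_ds]) auto
  then have "inj_on ((!) ds) {k. k < length ds \<and> word b x $ k = i}"
    by (auto simp: bij_betw_def intro: inj_on_subset)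
  then have "coord_count (word b x) i = card ((!) ds ` {k. k < length ds \<and> word b x $ k = i})"
    by (simp add: coord_count_def card_image)
  also have "(!) ds ` {k. k < length ds \<and> word b x $ k = i} = {y \<in> set ds. polar x y = i - b}"
    by (auto simp: word_def in_set_conv_nth image_iff eq_diff_eq)
  finally show ?thesis
    by (simp add: set_ds)
qed

lemma p_pos: "p > 0"
  using p_gt_1 by simp

text \<open>The functional of a nonzero \<open>x\<close> is thus not constant on the level set; this
  drives the injectivity of \<open>word\<close>.\<close>

lemma section_count_less:
  assumes "x \<noteq> 0"
  shows "section_count x a r < length ds"
proof -
  have "int (section_count x a r) \<le> int p ^ (e - 2) + int p ^ (m - 1)"
  proof (cases "form x = 0")
    case True
    then show ?thesis
      using assms section_count_isotropic_nonzero section_count_isotropic_zero a_nz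
      by (cases "r = 0") auto
  next
    case False
    then show ?thesis
      using qchar_cases[of "r\<^sup>2 - 4 * form x * a"]
      by (cases "r\<^sup>2 - 4 * form x * a = 0") (auto simp: section_count_anisotropic)
  qed
  also have "int p ^ (e - 2) < int p ^ (e - 1)"
    using p_gt_1 e_def m_pos by (intro power_strict_increasing) auto
  finally have "int (section_count x a r) < int (length ds)"
    by (simp add: length_ds_eq)
  then show ?thesis
    by simp
qed

lemma polar_diff: "polar (x - x') y = polar x y - polar x' y"
  using B_add[of y "x - x'" x'] by (simp add: B_commute[of _ y])

text \<open>Equal words make \<open>polar (x - x')\<close> constant on the level set, which forces x
  = x'; a single coordinate then compares b with b'.\<close>

lemma word_eq_iff: "word b x = word b' x' \<longleftrightarrow> b = b' \<and> x = x'"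
proof
  assume eq: "word b x = word b' x'"
  have *: "polar (x - x') y = b' - b" if "form y = a" for y
  proof -
    from that have "y \<in> set ds"
      using set_ds by simp
    then obtain k where k: "k < length ds" "y = ds ! k"
      by (auto simp: in_set_conv_nth)
    have "word b x $ k = word b' x' $ k"
      using eq by simp
    then show ?thesis
      using k by (simp add: word_def polar_diff algebra_simps)
  qed
  then have "section_count (x - x') a (b' - b) = length ds"
    unfolding length_ds by (metis (mono_tags, lifting) Collect_cong)
  then have x: "x = x'"
    using section_count_less[of "x - x'" "b' - b"] by auto
  have "length ds > 0"
    using p_pos by (simp add: length_ds_eq)
  then obtain y where "form y = a"
    using set_ds by (metis length_greater_0_conv list.set_sel(1) mem_Collect_eq)
  then have "b = b'"
    using *[of y] x by simp
  with x show "b = b' \<and> x = x'"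
    by simp
qed simp

lemma word_add: "word b x + word b' x' = word (b + b') (x + x')"
  by (rule eq_vecI) (auto simp: word_def polar_eq_tr_adj adj_add tr_add distrib_right)

lemma word_smult: "t \<cdot>\<^sub>v word b x = word (t * b) (emb t * x)"
  by (rule eq_vecI)
    (auto simp: word_def distrib_left B_commute[of _ "ds ! _"] B_scale)

lemma submodule_words: "submodule class_ring (\<Union>b. range (word b)) (module_vec TYPE('p mod_ring) (length ds))"
proof (unfold submodule_def, intro conjI allI impI)
  show "module class_ring (module_vec TYPE('p mod_ring) (length ds))"
    by (rule vec_module)
  show "(\<Union>b. range (word b)) \<subseteq> carrier (module_vec TYPE('p mod_ring) (length ds))"
    by (auto simp: module_vec_simps word_def)
  show "\<zero>\<^bsub>module_vec TYPE('p mod_ring) (length ds)\<^esub> \<in> (\<Union>b. range (word b))"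
  proof -
    have "0\<^sub>v (length ds) = word 0 0"
      by (rule eq_vecI) (auto simp: word_def)
    then show ?thesis
      by (auto simp: module_vec_simps)
  qed
qed (auto simp: module_vec_simps word_add word_smult, (blast intro: rangeI)+)

text \<open>\<open>word c 0\<close> is the constant word with entry c; as c is nonzero, its
  multiples supply every shift.\<close>

lemma code_span_eq:
  assumes c: "c \<noteq> 0"
  shows "code_span (length ds) (range (word c)) = (\<Union>b. range (word b))"
proof -
  let ?V = "module_vec TYPE('p mod_ring) (length ds)"
  interpret V: module class_ring ?V
    by (rule vec_module)
  have carr: "range (word c) \<subseteq> carrier ?V"
    by (auto simp: module_vec_simps word_def)
  interpret S: submodule class_ring "V.span (range (word c))" ?V
    by (rule V.span_is_submodule[OF carr])
  have sub: "range (word c) \<subseteq> V.span (range (word c))"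
    by (rule V.in_own_span[OF carr])
  have "word b x \<in> V.span (range (word c))" for b x
  proof -
    have "word c x \<in> V.span (range (word c))" "word c 0 \<in> V.span (range (word c))"
      using sub by auto
    then have "word c x + ((b - c) / c) \<cdot>\<^sub>v word c 0 \<in> V.span (range (word c))"
      using S.m_closed S.smult_closed by (simp add: module_vec_simps)
    also have "word c x + ((b - c) / c) \<cdot>\<^sub>v word c 0 = word b x"
      using c by (simp add: word_smult word_add)
    finally show ?thesis .
  qed
  moreover have "V.span (range (word c)) \<subseteq> (\<Union>b. range (word b))"
    by (rule V.span_is_subset[OF _ submodule_words]) auto
  ultimately show ?thesis
    unfolding code_span_def by auto
qed

lemma linear_code_words: "linear_code (length ds) (e + 1) (\<Union>b. range (word b))"
proof (rule linear_code_cardI[OF submodule_words])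
  have "(\<Union>b. range (word b)) = (\<lambda>(b, x). word b x) ` UNIV"
    by auto
  also have "card \<dots> = CARD('p mod_ring \<times> 'q)"
    by (intro card_image) (auto simp: inj_on_def word_eq_iff)
  also have "\<dots> = CARD('p mod_ring) ^ (e + 1)"
    by (simp add: card_q flip: p_def)
  finally show "card (\<Union>b. range (word b)) = CARD('p mod_ring) ^ (e + 1)" .
qed

section \<open>Weight distribution and complete weight enumerator\<close>

lemma card_p: "CARD('p mod_ring) = p"
  by (simp add: p_def)

lemma section_count_zero: "section_count 0 a r = (if r = 0 then length ds else 0)"
  by (simp add: length_ds)

lemma sum_by_form:
  fixes f :: "'q \<Rightarrow> 'r::comm_ring_1"
  assumes "f 0 = u" "\<And>x. x \<noteq> 0 \<Longrightarrow> form x = 0 \<Longrightarrow> f x = A" "\<And>x. form x \<noteq> 0 \<Longrightarrow> f x = T (form x)"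
  shows "(\<Sum>x\<in>UNIV. f x) = u + (of_nat p ^ (e - 1) - (of_nat p - 1) * of_nat p ^ (m - 1) - 1) * A
    + (of_nat p ^ (e - 1) + of_nat p ^ (m - 1)) * (\<Sum>s | s \<noteq> 0. T s)"
  using sum_by_level[of f u A T, OF assms] by (simp add: algebra_simps flip: p_def)

text \<open>The first three rows belong to the values -1, 0, 1 of the quadratic character at
  \<open>c\<^sup>2 - 4 * s * a\<close> with s = \<open>form x\<close>; the middle row also collects
  the nonzero isotropic x. The last row is the constant word x = 0.\<close>

lemma weight_distribution_words:
  assumes c: "c \<noteq> 0"
  shows "weight_distribution (range (word c))
       [((p - 1) * p ^ (e - 2),
           1 / 2 * (of_nat p - 1) * (of_nat p ^ (e - 1) + of_nat p ^ (m - 1))),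
        ((p - 1) * p ^ (e - 2) + p ^ (m - 1),
           2 * of_nat p ^ (e - 1) - (of_nat p - 2) * of_nat p ^ (m - 1) - 1),
        ((p - 1) * p ^ (e - 2) + 2 * p ^ (m - 1),
           1 / 2 * (of_nat p - 3) * (of_nat p ^ (e - 1) + of_nat p ^ (m - 1))),
        (p ^ (e - 1) + p ^ (m - 1), 1)]"
  unfolding weight_distribution_def
proof
  fix w
  \<comment> \<open>Indicator of weight w for a word with p^(e-2) - t p^(m-1) zeros; the 1 in
    \<open>1 + t\<close> comes from the p^(m-1) in the length. With indicators, rows of equal weight
    add up by themselves.\<close>
  define h :: "int \<Rightarrow> rat" where
    "h t = (if int ((p - 1) * p ^ (e - 2)) + (1 + t) * int p ^ (m - 1) = int w then 1 else 0)" for t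
  have e1: "int p ^ (e - 1) = int p * int p ^ (e - 2)"
    using power_e_minus_1 by (simp only: card_p)
  have weight: "int (hamming_weight (word c x)) = int (length ds) - int (section_count x a (- c))" for x
  proof -
    let ?N = "{k. k < length ds \<and> word c x $ k \<noteq> 0}" and ?Z = "{k. k < length ds \<and> word c x $ k = 0}"
    have "card (?N \<union> ?Z) = card ?N + card ?Z"
      by (rule card_Un_disjoint) auto
    moreover have "?N \<union> ?Z = {..<length ds}"
      by auto
    ultimately have "length ds = hamming_weight (word c x) + coord_count (word c x) 0"
      by (simp add: hamming_weight_def coord_count_def)
    then show ?thesis
      by (simp add: coord_count_word)
  qed
  have h_iff: "(if hamming_weight (word c x) = w then 1 else 0) = h t"
    if "int (section_count x a (- c)) = int p ^ (e - 2) - t * int p ^ (m - 1)" for x t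
  proof -
    have "int (hamming_weight (word c x)) = int ((p - 1) * p ^ (e - 2)) + (1 + t) * int p ^ (m - 1)"
      using p_pos by (simp add: weight that length_ds_eq e1[unfolded One_nat_def] of_nat_diff algebra_simps)
    then show ?thesis
      unfolding h_def by (metis of_nat_eq_iff)
  qed
  have "of_nat (card {v \<in> range (word c). hamming_weight v = w}) =
      (of_nat (card {x. hamming_weight (word c x) = w}) :: rat)"
  proof -
    have "{v \<in> range (word c). hamming_weight v = w} = word c ` {x. hamming_weight (word c x) = w}"
      by auto
    then show ?thesis
      by (simp add: card_image inj_on_def word_eq_iff)
  qed
  also have "\<dots> = (\<Sum>x\<in>UNIV. if hamming_weight (word c x) = w then 1 else 0)"
    by (simp flip: sum.inter_filter)
  also have "\<dots> = (if p ^ (e - 1) + p ^ (m - 1) = w then 1 else 0)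
    + (of_nat p ^ (e - 1) - (of_nat p - 1) * of_nat p ^ (m - 1) - 1) * h 0
    + (of_nat p ^ (e - 1) + of_nat p ^ (m - 1)) * (\<Sum>s | s \<noteq> 0. h (qchar (c\<^sup>2 - 4 * s * a)))"
  proof (rule sum_by_form)
    have "hamming_weight (word c 0) = length ds"
      using weight[of 0] c by (simp add: section_count_zero)
    then show "(if hamming_weight (word c 0) = w then 1 else 0) = (if p ^ (e - 1) + p ^ (m - 1) = w then 1 else (0::rat))"
      by (simp add: length_ds_eq)
    show "(if hamming_weight (word c x) = w then 1 else 0) = h 0" if "x \<noteq> 0" "form x = 0" for x
      using c that by (intro h_iff) (simp add: section_count_isotropic_nonzero)
    show "(if hamming_weight (word c x) = w then 1 else 0) = h (qchar (c\<^sup>2 - 4 * form x * a))"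
      if "form x \<noteq> 0" for x
      using that by (intro h_iff) (simp add: section_count_anisotropic)
  qed
  also have "(\<Sum>s | s \<noteq> 0. h (qchar (c\<^sup>2 - 4 * s * a))) =
      h 0 + (of_nat p - 3) / 2 * h 1 + (of_nat p - 1) / 2 * h (- 1)"
  proof -
    have four: "4 * a \<noteq> 0"
      using a_nz four_neq_zero[OF two] by simp
    have cls: "of_nat (card {u::'p mod_ring. qchar u = t}) = (of_nat p - 1) / (2::rat)" if "t = 1 \<or> t = -1" for t
    proof -
      have "2 * card {u::'p mod_ring. qchar u = t} = p - 1"
        using that card_qchar_classes[OF two] by (auto simp flip: p_def)
      then have "of_nat (2 * card {u::'p mod_ring. qchar u = t}) = (of_nat (p - 1) :: rat)"
        by (simp only:)
      then show ?thesis
        using p_pos by (simp add: of_nat_diff)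
    qed
    \<comment> \<open>Excluding s = 0 excludes u = c^2, a nonzero square: hence p - 3 for squares
      against p - 1 for nonsquares.\<close>
    have "(\<Sum>s | s \<noteq> 0. h (qchar (c\<^sup>2 - 4 * s * a))) = (\<Sum>u\<in>UNIV - {c\<^sup>2}. h (qchar u))"
      by (rule sum.reindex_bij_witness[of _ "\<lambda>u. (c\<^sup>2 - u) / (4 * a)" "\<lambda>s. c\<^sup>2 - 4 * s * a"])
        (use four a_nz in auto)
    also have "\<dots> = (\<Sum>u\<in>UNIV. h (qchar (u :: 'p mod_ring))) - h 1"
      using c by (simp add: sum_diff1 qchar_square)
    also have "(\<Sum>u\<in>UNIV. h (qchar (u :: 'p mod_ring))) =
        (\<Sum>u\<in>(UNIV :: 'p mod_ring set). (if u = 0 then h 0 else 0) + (if qchar u = 1 then h 1 else 0)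
          + (if qchar u = -1 then h (-1) else 0))"
      by (intro sum.cong refl) (auto dest: qchar_cases)
    also have "\<dots> = h 0 + of_nat (card {u::'p mod_ring. qchar u = 1}) * h 1
        + of_nat (card {u::'p mod_ring. qchar u = -1}) * h (-1)"
      by (simp add: sum.distrib flip: sum.inter_filter)
    finally show ?thesis
      by (simp add: cls field_simps)
  qed
  finally have main: "of_nat (card {v \<in> range (word c). hamming_weight v = w}) =
    (if p ^ (e - 1) + p ^ (m - 1) = w then 1 else 0)
    + (of_nat p ^ (e - 1) - (of_nat p - 1) * of_nat p ^ (m - 1) - 1) * h 0
    + (of_nat p ^ (e - 1) + of_nat p ^ (m - 1))
      * (h 0 + (of_nat p - 3) / 2 * h 1 + (of_nat p - 1) / 2 * h (- 1))" .
  have h0: "h 0 = (if (p - 1) * p ^ (e - 2) + p ^ (m - 1) = w then 1 else 0)"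
    unfolding h_def by (simp flip: of_nat_power of_nat_add of_nat_mult)
  have h1: "h 1 = (if (p - 1) * p ^ (e - 2) + 2 * p ^ (m - 1) = w then 1 else 0)"
  proof -
    have "int ((p - 1) * p ^ (e - 2)) + (1 + 1) * int p ^ (m - 1) = int ((p - 1) * p ^ (e - 2) + 2 * p ^ (m - 1))"
      by simp
    then show ?thesis
      unfolding h_def by (simp only: of_nat_eq_iff)
  qed
  have h2: "h (- 1) = (if (p - 1) * p ^ (e - 2) = w then 1 else 0)"
    unfolding h_def by (simp flip: of_nat_power of_nat_add of_nat_mult)
  have pick: "(if P then x else 0) = x * (if P then 1 else (0::rat))" for P x
    by simp
  show "of_nat (card {v \<in> range (word c). hamming_weight v = w}) =
    (\<Sum>(u, A)\<leftarrow>[((p - 1) * p ^ (e - 2),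
           1 / 2 * (of_nat p - 1) * (of_nat p ^ (e - 1) + of_nat p ^ (m - 1))),
        ((p - 1) * p ^ (e - 2) + p ^ (m - 1),
           2 * of_nat p ^ (e - 1) - (of_nat p - 2) * of_nat p ^ (m - 1) - 1),
        ((p - 1) * p ^ (e - 2) + 2 * p ^ (m - 1),
           1 / 2 * (of_nat p - 3) * (of_nat p ^ (e - 1) + of_nat p ^ (m - 1))),
        (p ^ (e - 1) + p ^ (m - 1), 1)]. if u = w then A else (0::rat))"
    unfolding main list.map sum_list.Cons sum_list.Nil prod.case
    unfolding pick[of "_ = w" "1 / 2 * _ * _"] pick[of "_ = w" "2 * _ - _ - 1"] h0[symmetric] h1[symmetric] h2[symmetric]
    by (simp add: field_simps)
qed

lemma codeword_cwe_word:
  "codeword_cwe (word c x) = unknown c ^ section_count x a 0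
     * (\<Prod>j | j \<noteq> 0. unknown (j + c) ^ section_count x a j)"
proof -
  have "codeword_cwe (word c x) = (\<Prod>i\<in>UNIV. unknown i ^ section_count x a (i - c))"
    by (simp add: codeword_cwe_def coord_count_word)
  also have "\<dots> = (\<Prod>j\<in>UNIV. unknown (j + c) ^ section_count x a j)"
    by (rule prod.reindex_bij_witness[of _ "\<lambda>j. j + c" "\<lambda>i. i - c"]) auto
  also have "\<dots> = unknown (0 + c) ^ section_count x a 0
      * (\<Prod>j\<in>UNIV - {0}. unknown (j + c) ^ section_count x a j)"
    by (rule prod.remove) auto
  also have "UNIV - {0} = {j::'p mod_ring. j \<noteq> 0}"
    by auto
  finally show ?thesis
    by simp
qed

text \<open>For s = \<open>form x\<close> nonzero, the exponent of the unknown at c depends on the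
  character of -4 a s, that is, on whether s lies in the square class of a; this gives the two sums.
  The separate term is s = c^2 / (4 a), which lies in the class of a because 4 a s is then a
  square.\<close>

lemma cwe_words:
  assumes c: "c \<noteq> 0"
  shows "cwe (range (word c)) =
       unknown c ^ (p ^ (e - 1) + p ^ (m - 1))
       + (of_nat p ^ (e - 1) - (of_nat p - 1) * of_nat p ^ (m - 1) - 1)
         * (unknown c ^ (p ^ (e - 2) + p ^ (m - 1))
            * (\<Prod>i | i \<noteq> 0. unknown (i + c) ^ (p ^ (e - 2))))
       + (of_nat p ^ (e - 1) + of_nat p ^ (m - 1))
         * (unknown c ^ nat (int p ^ (e - 2) - legendre_symbol (-1 :: 'p mod_ring) * int p ^ (m - 1))
            * (\<Prod>i | i \<noteq> 0. unknown (i + c)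
                 ^ nat (int p ^ (e - 2) - legendre_symbol (i\<^sup>2 - c\<^sup>2) * int p ^ (m - 1))))
       + (of_nat p ^ (e - 1) + of_nat p ^ (m - 1))
         * (\<Sum>i | i \<noteq> 0 \<and> i \<noteq> inverse (4 * a) * c\<^sup>2 \<and> legendre_symbol i = legendre_symbol a.
              unknown c ^ nat (int p ^ (e - 2) - legendre_symbol (-1 :: 'p mod_ring) * int p ^ (m - 1))
              * (\<Prod>j | j \<noteq> 0. unknown (j + c)
                   ^ nat (int p ^ (e - 2) - legendre_symbol (j\<^sup>2 - 4 * a * i) * int p ^ (m - 1))))
       + (of_nat p ^ (e - 1) + of_nat p ^ (m - 1))
         * (\<Sum>i | i \<noteq> 0 \<and> legendre_symbol i \<noteq> legendre_symbol a.
              unknown c ^ nat (int p ^ (e - 2) + legendre_symbol (-1 :: 'p mod_ring) * int p ^ (m - 1))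
              * (\<Prod>j | j \<noteq> 0. unknown (j + c)
                   ^ nat (int p ^ (e - 2) - legendre_symbol (j\<^sup>2 - 4 * a * i) * int p ^ (m - 1))))"
proof -
  define R :: "'p mod_ring \<Rightarrow> 'p mod_ring int_mpoly" where
    "R s = (\<Prod>j | j \<noteq> 0. unknown (j + c)
        ^ nat (int p ^ (e - 2) - qchar (j\<^sup>2 - 4 * a * s) * int p ^ (m - 1)))" for s
  define T where
    "T s = unknown c ^ nat (int p ^ (e - 2) - qchar (- 4 * a * s) * int p ^ (m - 1)) * R s" for s
  define s0 where "s0 = inverse (4 * a) * c\<^sup>2"
  have four: "4 * a \<noteq> 0"
    using a_nz four_neq_zero[OF two] by simp
  have s0: "s0 \<noteq> 0" "4 * a * s0 = c\<^sup>2"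
    using four c by (auto simp: s0_def mult.assoc[symmetric])
  have qchar4: "qchar (4 :: 'p mod_ring) = 1"
    using qchar_square[OF two] by simp
  have qchar_s0: "qchar s0 = qchar a"
  proof -
    have "qchar (4 * a * s0) = 1"
      unfolding s0(2) using c by (rule qchar_square)
    then have "qchar (4 :: 'p mod_ring) * qchar a * qchar s0 = 1"
      by (simp only: qchar_mult[OF two])
    then show ?thesis
      using qchar4 qchar_cases[OF a_nz] by auto
  qed
  have qchar_neg: "qchar (- 4 * a * s) = qchar (-1 :: 'p mod_ring) * (qchar a * qchar s)" for s
  proof -
    have "- 4 * a * s = - 1 * (4 * (a * s))"
      by simp
    then show ?thesis
      by (simp only: qchar_mult[OF two] qchar4 mult_1)
  qed
  have T_eq: "T s = unknown c ^ nat (int p ^ (e - 2) - qchar (-1 :: 'p mod_ring) * int p ^ (m - 1)) * R s"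
    if "s \<noteq> 0" "qchar s = qchar a" for s
    unfolding T_def qchar_neg using that qchar_cases[OF a_nz] by auto
  have T_neq: "T s = unknown c ^ nat (int p ^ (e - 2) + qchar (-1 :: 'p mod_ring) * int p ^ (m - 1)) * R s"
    if "s \<noteq> 0" "qchar s \<noteq> qchar a" for s
    unfolding T_def qchar_neg using that qchar_cases[OF a_nz] qchar_cases[OF that(1)] by auto
  have "cwe (range (word c)) = (\<Sum>x\<in>UNIV. codeword_cwe (word c x))"
    unfolding cwe_def by (subst sum.reindex) (auto simp: inj_on_def word_eq_iff)
  also have "\<dots> = unknown c ^ (p ^ (e - 1) + p ^ (m - 1))
      + (of_nat p ^ (e - 1) - (of_nat p - 1) * of_nat p ^ (m - 1) - 1)
        * (unknown c ^ (p ^ (e - 2) + p ^ (m - 1)) * (\<Prod>i | i \<noteq> 0. unknown (i + c) ^ (p ^ (e - 2))))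
      + (of_nat p ^ (e - 1) + of_nat p ^ (m - 1)) * (\<Sum>s | s \<noteq> 0. T s)"
  proof (rule sum_by_form)
    show "codeword_cwe (word c 0) = unknown c ^ (p ^ (e - 1) + p ^ (m - 1))"
      unfolding codeword_cwe_word section_count_zero by (simp add: length_ds_eq)
  next
    fix x
    assume x: "x \<noteq> 0" "form x = 0"
    have "int (section_count x a 0) = int (p ^ (e - 2) + p ^ (m - 1))"
      using x a_nz by (simp add: section_count_isotropic_zero)
    moreover have "int (section_count x a j) = int (p ^ (e - 2))" if "j \<noteq> 0" for j
      using x that by (simp add: section_count_isotropic_nonzero)
    ultimately show "codeword_cwe (word c x) =
        unknown c ^ (p ^ (e - 2) + p ^ (m - 1)) * (\<Prod>i | i \<noteq> 0. unknown (i + c) ^ (p ^ (e - 2)))"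
      unfolding codeword_cwe_word of_nat_eq_iff by simp
  next
    fix x
    assume "form x \<noteq> 0"
    then have int: "int (section_count x a j) = int p ^ (e - 2) - qchar (j\<^sup>2 - 4 * a * form x) * int p ^ (m - 1)" for j
      by (simp add: section_count_anisotropic mult_ac)
    \<comment> \<open>The integer exponent is a cardinality, so \<open>nat\<close> truncates
      nothing.\<close>
    have "section_count x a j = nat (int p ^ (e - 2) - qchar (j\<^sup>2 - 4 * a * form x) * int p ^ (m - 1))" for j
      unfolding int[symmetric] by (rule nat_int[symmetric])
    then show "codeword_cwe (word c x) = T (form x)"
      by (simp add: codeword_cwe_word T_def R_def)
  qed
  also have "(\<Sum>s | s \<noteq> 0. T s) = (\<Sum>s | s \<noteq> 0 \<and> qchar s = qchar a. T s) + (\<Sum>s | s \<noteq> 0 \<and> qchar s \<noteq> qchar a. T s)"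
  proof -
    let ?X = "{s :: 'p mod_ring. s \<noteq> 0 \<and> qchar s = qchar a}" and ?Y = "{s :: 'p mod_ring. s \<noteq> 0 \<and> qchar s \<noteq> qchar a}"
    have "sum T (?X \<union> ?Y) = sum T ?X + sum T ?Y"
      by (rule sum.union_disjoint) auto
    moreover have "?X \<union> ?Y = {s. s \<noteq> 0}"
      by blast
    ultimately show ?thesis
      by (simp only:)
  qed
  also have "(\<Sum>s | s \<noteq> 0 \<and> qchar s = qchar a. T s) =
      T s0 + (\<Sum>s\<in>{s. s \<noteq> 0 \<and> qchar s = qchar a} - {s0}. T s)"
    using s0 qchar_s0 by (intro sum.remove) auto
  also have "{s. s \<noteq> 0 \<and> qchar s = qchar a} - {s0} = {s. s \<noteq> 0 \<and> s \<noteq> s0 \<and> qchar s = qchar a}"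
    by auto
  also have "T s0 = unknown c ^ nat (int p ^ (e - 2) - qchar (-1 :: 'p mod_ring) * int p ^ (m - 1)) * R s0"
    using s0 qchar_s0 by (intro T_eq)
  also have "(\<Sum>s | s \<noteq> 0 \<and> s \<noteq> s0 \<and> qchar s = qchar a. T s) = (\<Sum>s | s \<noteq> 0 \<and> s \<noteq> s0 \<and> qchar s = qchar a.
      unknown c ^ nat (int p ^ (e - 2) - qchar (-1 :: 'p mod_ring) * int p ^ (m - 1)) * R s)"
    by (intro sum.cong) (auto simp: T_eq)
  also have "(\<Sum>s | s \<noteq> 0 \<and> qchar s \<noteq> qchar a. T s) = (\<Sum>s | s \<noteq> 0 \<and> qchar s \<noteq> qchar a.
      unknown c ^ nat (int p ^ (e - 2) + qchar (-1 :: 'p mod_ring) * int p ^ (m - 1)) * R s)"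
    by (intro sum.cong) (auto simp: T_neq)
  finally show ?thesis
    unfolding legendre_symbol_eq_qchar s0_def[symmetric] R_def s0(2) distrib_left by (simp only: add.assoc)
qed

end

theorem theorem2p2:
  fixes p m \<alpha> e q d :: nat
    and a c :: "'p::prime_card mod_ring"
    and ds :: "'q::finite_field list"
    and C :: "'p mod_ring vec set"
  assumes "p = CARD('p)" and "odd p"
    and "m > 0" and "\<alpha> > 0"
    and "e = 2 * m" and "q = p ^ e" and "CARD('q) = q"
    and "d = gcd \<alpha> e"
    and "d dvd m" and "odd (m div d)"
    and "a \<noteq> 0" and "c \<noteq> 0"
    and "distinct ds" and "set ds = {x. fp_trace e (x ^ (p ^ \<alpha> + 1)) = a}"
    and "C = shifted_trace_code e ds c"
  shows
    "length ds = p ^ (e - 1) + p ^ (m - 1) \<and>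
     code_span (length ds) C = (\<Union>b. shifted_trace_code e ds b) \<and>
     linear_code (p ^ (e - 1) + p ^ (m - 1)) (e + 1) (code_span (length ds) C) \<and>
     weight_distribution C
       [((p - 1) * p ^ (e - 2),
           1 / 2 * (of_nat p - 1) * (of_nat p ^ (e - 1) + of_nat p ^ (m - 1))),
        ((p - 1) * p ^ (e - 2) + p ^ (m - 1),
           2 * of_nat p ^ (e - 1) - (of_nat p - 2) * of_nat p ^ (m - 1) - 1),
        ((p - 1) * p ^ (e - 2) + 2 * p ^ (m - 1),
           1 / 2 * (of_nat p - 3) * (of_nat p ^ (e - 1) + of_nat p ^ (m - 1))),
        (p ^ (e - 1) + p ^ (m - 1), 1)] \<and>
     cwe C =
       unknown c ^ (p ^ (e - 1) + p ^ (m - 1))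
       + (of_nat p ^ (e - 1) - (of_nat p - 1) * of_nat p ^ (m - 1) - 1)
         * (unknown c ^ (p ^ (e - 2) + p ^ (m - 1))
            * (\<Prod>i | i \<noteq> 0. unknown (i + c) ^ (p ^ (e - 2))))
       + (of_nat p ^ (e - 1) + of_nat p ^ (m - 1))
         * (unknown c ^ nat (int p ^ (e - 2) - legendre_symbol (-1 :: 'p mod_ring) * int p ^ (m - 1))
            * (\<Prod>i | i \<noteq> 0. unknown (i + c)
                 ^ nat (int p ^ (e - 2) - legendre_symbol (i\<^sup>2 - c\<^sup>2) * int p ^ (m - 1))))
       + (of_nat p ^ (e - 1) + of_nat p ^ (m - 1))
         * (\<Sum>i | i \<noteq> 0 \<and> i \<noteq> inverse (4 * a) * c\<^sup>2 \<and> legendre_symbol i = legendre_symbol a.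
              unknown c ^ nat (int p ^ (e - 2) - legendre_symbol (-1 :: 'p mod_ring) * int p ^ (m - 1))
              * (\<Prod>j | j \<noteq> 0. unknown (j + c)
                   ^ nat (int p ^ (e - 2) - legendre_symbol (j\<^sup>2 - 4 * a * i) * int p ^ (m - 1))))
       + (of_nat p ^ (e - 1) + of_nat p ^ (m - 1))
         * (\<Sum>i | i \<noteq> 0 \<and> legendre_symbol i \<noteq> legendre_symbol a.
              unknown c ^ nat (int p ^ (e - 2) + legendre_symbol (-1 :: 'p mod_ring) * int p ^ (m - 1))
              * (\<Prod>j | j \<noteq> 0. unknown (j + c)
                   ^ nat (int p ^ (e - 2) - legendre_symbol (j\<^sup>2 - 4 * a * i) * int p ^ (m - 1))))"
proof -
  have card: "CARD('q) = p ^ e"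
    using \<open>CARD('q) = q\<close> \<open>q = p ^ e\<close> by (rule trans)
  interpret trace_form "TYPE('p)" "TYPE('q)" p e m \<alpha> d
    by unfold_locales (fact assms card)+
  have form: "set ds = {x. form x = a}"
    unfolding form_def by fact
  interpret trace_code "TYPE('p)" "TYPE('q)" p e m \<alpha> d a ds
    by unfold_locales (fact assms card form)+
  have C: "C = range (word c)"
    using assms shifted_trace_code_eq by simp
  show ?thesis
    using length_ds_eq code_span_eq[OF \<open>c \<noteq> 0\<close>] linear_code_words weight_distribution_words[OF \<open>c \<noteq> 0\<close>]
      cwe_words[OF \<open>c \<noteq> 0\<close>]
    by (simp only: C shifted_trace_code_eq simp_thms)
qed

end
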